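(* Let $\bm{p}=(p_j)_{j\ge 1}$ be a probability distribution with $p_j>0$ for all $j\ge1$ and $\sum_{j\ge1}p_j=1$, and for $x\in(0,1]$ let $\vec{\nu}(x)=\#\{j\ge1: p_j\ge x\}$. Assume that there exist $\alpha\in(0,1)$ and a function $L$ slowly varying at infinity such that $$\vec{\nu}(x)=x^{-\alpha}L(x^{-1}),\qquad x\in(0,1].$$ Let $H(\bm{p})$ be the Shannon entropy of $\bm p$ and let $\hat H_n$ be the plug-in entropy estimator based on a multinomial sample of size $n$ from $\bm p$. Then, as $n\to\infty$, $$\left|\mathsf{E}[\hat H_n]-H(\bm{p})\right|\ \sim\ n^{\alpha-1}L(n)\,C_\alpha,$$ where $$C_\alpha=\int_0^\infty y^{-\alpha}\psi(y)\,\mathrm{d}y,\qquad \psi(y)=-\log y-1+\mathsf{E}\left[(P_y+1-y)\log(P_y+1)\right]\quad(y>0),$$ and $P_y$ denotes a Poisson random variable with mean $y$.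
   Context: The Shannon entropy is $H(\bm{p})=-\sum_{j\ge1}p_j\log p_j$ (natural logarithm); it is finite under the stated assumption on $\vec\nu$. For an integer $n\ge2$, let $(X_{n,j})_{j\ge1}$ follow the (infinite-dimensional) multinomial distribution with sample size $n$ and probability vector $\bm p$, i.e. $\mathsf{P}(X_{n,j}=n_j,\ j\in\mathbb{N})=\frac{n!}{\prod_{j\ge1}n_j!}\prod_{j\ge1}p_j^{n_j}$ for non-negative integers $(n_j)_{j\ge1}$ with $\sum_{j\ge1}n_j=n$ (equivalently, $X_{n,j}$ is the number of observations equal to $j$ among $n$ i.i.d. draws from $\bm p$). The plug-in estimator is $$\hat H_n=-\sum_{j\ge1}\frac{X_{n,j}}{n}\log\left(\frac{X_{n,j}}{n}\right),$$ with the convention $0\log0=0$. A function $L$ is slowly varying (at infinity) if $\lim_{x\to\infty}L(\lambda x)/L(x)=1$ for every $\lambda>0$; here $L$ is defined on $[1,\infty)$ and positive for all sufficiently large arguments (the displayed identity forces $L(u)=0$ for $1\le u<1/\max_j p_j$). The notation $a_n\sim b_n$ means $a_n/b_n\to1$. *)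

theory Defs
  imports "HOL-Probability.Probability"
begin

text \<open>
  Probability vectors are indexed by all of \<^typ>\<open>nat\<close>, i.e. the index set
  \<open>{1, 2, \<dots>}\<close> is relabelled as \<open>{0, 1, \<dots>}\<close>.
\<close>

definition tail_count :: "(nat \<Rightarrow> real) \<Rightarrow> real \<Rightarrow> nat"
  where "tail_count p x = card {j. p j \<ge> x}"

text \<open>
  Only the behaviour at infinity matters, so that a function defined on \<open>[1, \<infinity>)\<close>
  may be extended arbitrarily to a total one.
\<close>

definition slowly_varying :: "(real \<Rightarrow> real) \<Rightarrow> bool"
  where "slowly_varying L \<longleftrightarrow>
    (\<forall>\<^sub>F x in at_top. L x > 0) \<and>
    (\<forall>c>0. ((\<lambda>x. L (c * x) / L x) \<longlongrightarrow> 1) at_top)"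

definition shannon_entropy :: "(nat \<Rightarrow> real) \<Rightarrow> real"
  where "shannon_entropy p = - (\<Sum>j. p j * ln (p j))"

text \<open>
  The count vectors \<open>m\<close> with total \<open>n\<close> are exactly the finitely supported ones
  whose entries on the support sum to \<open>n\<close>; outside of the support all factors of
  the two infinite products equal \<open>1\<close>.
\<close>

definition multinomial_vector ::
    "'a measure \<Rightarrow> nat \<Rightarrow> (nat \<Rightarrow> real) \<Rightarrow> (nat \<Rightarrow> 'a \<Rightarrow> nat) \<Rightarrow> bool"
  where "multinomial_vector M n p X \<longleftrightarrow>
    prob_space M \<and>
    (\<forall>j. X j \<in> measurable M (count_space UNIV)) \<and>
    (\<forall>m :: nat \<Rightarrow> nat. finite {j. m j \<noteq> 0} \<and> (\<Sum>j | m j \<noteq> 0. m j) = n \<longrightarrow>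
       measure M {\<omega> \<in> space M. \<forall>j. X j \<omega> = m j} =
         fact n / (\<Prod>j | m j \<noteq> 0. fact (m j)) * (\<Prod>j | m j \<noteq> 0. p j ^ m j))"

text \<open>The convention \<open>0 log 0 = 0\<close> is automatic, since the first factor vanishes.\<close>

definition plugin_entropy :: "nat \<Rightarrow> (nat \<Rightarrow> nat) \<Rightarrow> real"
  where "plugin_entropy n m = - (\<Sum>j. real (m j) / real n * ln (real (m j) / real n))"

definition psi :: "real \<Rightarrow> real"
  where "psi y = - ln y - 1 +
    measure_pmf.expectation (poisson_pmf y) (\<lambda>k. (real k + 1 - y) * ln (real k + 1))"

definition C_const :: "real \<Rightarrow> real"
  where "C_const \<alpha> = (LBINT y:{0<..}. y powr (- \<alpha>) * psi y)"

end

theory Submission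
  imports Defs "HOL-Real_Asymp.Real_Asymp" "HOL-Combinatorics.Multiset_Permutations"
begin

text \<open>
  Put \<open>\<phi> t = t ln t\<close>. The count of the symbol \<open>j\<close> has the binomial law with parameters \<open>n\<close>
  and \<open>p j\<close>, so that \<open>n\<close> times the (negative) bias of the plug-in estimator is \<open>\<Sum>j. h\<^sub>n (n p\<^sub>j)\<close>,
  where \<open>h\<^sub>n y = E \<phi>(B) - \<phi>(y)\<close> for a binomial \<open>B\<close> with parameters \<open>n\<close> and \<open>y / n\<close>. Since
  \<open>h\<^sub>n 0 = 0\<close>, writing \<open>h\<^sub>n\<close> as the integral of its derivative and exchanging sum and integral gives
  \<open>\<Sum>j. h\<^sub>n (n p\<^sub>j) = \<integral> h\<^sub>n' y \<nu>(y / n) dy\<close> over \<open>(0, \<infinity>)\<close>, with \<open>\<nu>\<close> the counting function of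
  the masses; see \<open>bias_fun_sums_integral\<close>.

  Differentiating a binomial expectation produces the expectation, for one trial less, of the
  increments of the function. Hence \<open>h\<^sub>n' y = E (\<phi>(B + 1) - \<phi>(B)) - ln y - 1\<close> with \<open>B\<close> binomial
  with parameters \<open>n - 1\<close> and \<open>y / n\<close>. The Poisson limit of this quantity is exactly \<open>psi y\<close>,
  because \<open>E (P ln P) = y E (ln (P + 1))\<close> for a Poisson variable \<open>P\<close> with mean \<open>y\<close>
  (\<open>bias_deriv_tendsto_psi\<close>). Thus the passage from the multinomial to the Poisson model happens
  pointwise under the integral sign.

  Regular variation gives \<open>\<nu>(y / n) / \<nu>(1 / n) \<longrightarrow> y powr -\<alpha>\<close>, so the integrand divided by
  \<open>\<nu>(1 / n)\<close> tends to \<open>y powr -\<alpha> * psi y\<close>. Dominated convergence applies: the elementary estimate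
  \<open>1 - 1 / t \<le> ln t \<le> t - 1\<close> yields \<open>\<bar>h\<^sub>n' y\<bar> \<le> 1 / y\<close> uniformly in \<open>n\<close>, with only a logarithmic
  singularity at \<open>0\<close> (\<open>bias_deriv_bounds\<close>), while Potter's bounds control the ratio of the
  counting functions by \<open>y powr (-\<alpha> \<plusminus> \<delta>)\<close> (\<open>potter_bounds\<close>). As \<open>\<nu>(1 / n) = n powr \<alpha> * L n\<close>, this
  is the claim up to the positivity of the constant. For the latter, all \<open>h\<^sub>n (n p\<^sub>j)\<close> are
  nonnegative, and the symbols with \<open>n p\<^sub>j\<close> between \<open>1 / 4\<close> and \<open>1 / 2\<close> alone contribute a positive
  multiple of \<open>\<nu>(1 / n)\<close> (\<open>C_const_pos\<close>).
\<close>

section \<open>Binomial expectations\<close>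

text \<open>
  The expectation of \<open>f\<close> under the binomial law, as a function of an unrestricted real \<open>x\<close>: it is
  a polynomial in \<open>x\<close>, which is what the differentiation below needs.
\<close>
definition binom_mean :: "nat \<Rightarrow> real \<Rightarrow> (nat \<Rightarrow> real) \<Rightarrow> real"
  where "binom_mean n x f = (\<Sum>k\<le>n. Bernstein n k x * f k)"

lemma binom_mean_0 [simp]: "binom_mean 0 x f = f 0"
  by (simp add: binom_mean_def Bernstein_def)

lemma binom_mean_Suc:
  "binom_mean (Suc n) x f = x * binom_mean n x (\<lambda>k. f (Suc k)) + (1 - x) * binom_mean n x f"
proof -
  have split: "Bernstein (Suc n) (Suc k) x = x * Bernstein n k x + (1 - x) * Bernstein n (Suc k) x"
    if "k \<le> n" for k
  proof (cases "k = n")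
    case True then show ?thesis by (simp add: Bernstein_def)
  next
    case False
    with that have "n - k = Suc (n - Suc k)" by simp
    then show ?thesis by (simp add: Bernstein_def algebra_simps)
  qed
  have "binom_mean (Suc n) x f =
      Bernstein (Suc n) 0 x * f 0 + (\<Sum>k\<le>n. Bernstein (Suc n) (Suc k) x * f (Suc k))"
    unfolding binom_mean_def by (subst sum.atMost_Suc_shift) simp
  also have "(\<Sum>k\<le>n. Bernstein (Suc n) (Suc k) x * f (Suc k)) =
      x * binom_mean n x (\<lambda>k. f (Suc k)) + (1 - x) * (\<Sum>k\<le>n. Bernstein n (Suc k) x * f (Suc k))"
    unfolding binom_mean_def sum_distrib_left sum.distrib[symmetric]
    by (rule sum.cong) (auto simp: split algebra_simps)
  also have "(\<Sum>k\<le>n. Bernstein n (Suc k) x * f (Suc k)) = binom_mean n x f - Bernstein n 0 x * f 0"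
  proof -
    have "(\<Sum>k\<le>Suc n. Bernstein n k x * f k) = binom_mean n x f"
      by (simp add: binom_mean_def Bernstein_def)
    then show ?thesis by (subst (asm) sum.atMost_Suc_shift) simp
  qed
  finally show ?thesis by (simp add: Bernstein_def algebra_simps)
qed

lemma binom_mean_add: "binom_mean n x (\<lambda>k. f k + g k) = binom_mean n x f + binom_mean n x g"
  by (simp add: binom_mean_def algebra_simps sum.distrib)

lemma binom_mean_cmult: "binom_mean n x (\<lambda>k. c * f k) = c * binom_mean n x f"
  by (simp add: binom_mean_def sum_distrib_left mult_ac)

lemma binom_mean_diff: "binom_mean n x (\<lambda>k. f k - g k) = binom_mean n x f - binom_mean n x g"
  by (simp add: binom_mean_def algebra_simps sum_subtractf)

lemma binom_mean_const [simp]: "binom_mean n x (\<lambda>k. c) = c"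
  by (simp add: binom_mean_def flip: sum_distrib_right)

lemma binom_mean_of_nat [simp]: "binom_mean n x real = real n * x"
  using sum_k_Bernstein[of n x] by (simp add: binom_mean_def mult_ac)

lemma binom_mean_mono:
  assumes "0 \<le> x" "x \<le> 1" "\<And>k. f k \<le> g k"
  shows "binom_mean n x f \<le> binom_mean n x g"
  unfolding binom_mean_def
  by (intro sum_mono mult_left_mono assms Bernstein_nonneg)

lemma binom_mean_at_0 [simp]: "binom_mean n 0 f = f 0"
  by (induction n) (auto simp: binom_mean_Suc)

text \<open>
  Weighting a binomial variable by its own value amounts to forcing one of the trials to succeed.
\<close>
lemma binom_mean_size_bias:
  "binom_mean (Suc n) x (\<lambda>k. real k * f k) = real (Suc n) * x * binom_mean n x (\<lambda>k. f (Suc k))"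
proof (induction n arbitrary: f)
  case 0
  then show ?case by (simp add: binom_mean_Suc)
next
  case (Suc n)
  define B where "B = binom_mean (Suc n) x (\<lambda>k. f (Suc k))"
  have "binom_mean (Suc (Suc n)) x (\<lambda>k. real k * f k)
      = x * (binom_mean (Suc n) x (\<lambda>k. real k * f (Suc k)) + B)
        + (1 - x) * binom_mean (Suc n) x (\<lambda>k. real k * f k)"
    unfolding B_def by (subst binom_mean_Suc) (simp add: algebra_simps flip: binom_mean_add)
  also have "\<dots> = x * B + real (Suc n) * x *
      (x * binom_mean n x (\<lambda>k. f (Suc (Suc k))) + (1 - x) * binom_mean n x (\<lambda>k. f (Suc k)))"
    using Suc.IH[of f] Suc.IH[of "\<lambda>k. f (Suc k)"] by (simp add: algebra_simps)
  also have "\<dots> = x * B + real (Suc n) * x * B"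
    unfolding B_def binom_mean_Suc[of n x "\<lambda>k. f (Suc k)"] ..
  finally show ?case by (simp add: B_def algebra_simps)
qed

text \<open>
  Raising the success probability flips single trials from failure to success. Formally, the
  derivative of the recursion \<open>binom_mean_Suc\<close> gives the difference of its two branches
  plus the terms from the induction hypothesis, and these recombine by the same recursion.
\<close>
lemma has_real_derivative_binom_mean:
  "((\<lambda>x. binom_mean (Suc n) x f) has_real_derivative
     real (Suc n) * binom_mean n x (\<lambda>k. f (Suc k) - f k)) (at x)"
proof (induction n arbitrary: f)
  case 0
  show ?case
    unfolding binom_mean_Suc binom_mean_0 by (auto intro!: derivative_eq_intros)
next
  case (Suc n)
  define D where "D = (\<lambda>k. f (Suc k) - f k)"
  have "binom_mean (Suc n) x (\<lambda>k. f (Suc k)) - binom_mean (Suc n) x f = binom_mean (Suc n) x D"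
    by (simp add: D_def binom_mean_diff)
  moreover have "binom_mean (Suc n) x D =
      x * binom_mean n x (\<lambda>k. D (Suc k)) + (1 - x) * binom_mean n x D"
    by (rule binom_mean_Suc)
  moreover have "a + x * (N * u) + (- b + (1 - x) * (N * v)) = (N + 1) * B"
    if "a - b = B" "B = x * u + (1 - x) * v" for a b B N u v :: real
  proof -
    have "a = b + B" using that(1) by simp
    then show ?thesis unfolding that(2) by (simp add: algebra_simps)
  qed
  ultimately have eq:
    "binom_mean (Suc n) x (\<lambda>k. f (Suc k)) + x * (real (Suc n) * binom_mean n x (\<lambda>k. D (Suc k))) +
     (- binom_mean (Suc n) x f + (1 - x) * (real (Suc n) * binom_mean n x D)) =
     (real (Suc n) + 1) * binom_mean (Suc n) x D"
    by blast
  have "((\<lambda>x. x * binom_mean (Suc n) x (\<lambda>k. f (Suc k)) + (1 - x) * binom_mean (Suc n) x f)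
      has_real_derivative (real (Suc n) + 1) * binom_mean (Suc n) x D) (at x)"
    unfolding eq[symmetric] unfolding D_def
    by (auto intro!: derivative_eq_intros Suc.IH simp: algebra_simps)
  then show ?case
    unfolding D_def by (subst binom_mean_Suc) (simp add: add_ac)
qed

text \<open>
  Size biasing with \<open>f k = 1 / k\<close> turns the left-hand side into the probability of a positive
  count, divided by the mean.
\<close>
lemma binom_mean_inverse_Suc_le:
  assumes "0 < x" "x \<le> 1"
  shows "binom_mean n x (\<lambda>k. 1 / real (Suc k)) \<le> 1 / (real (Suc n) * x)"
proof -
  have "real (Suc n) * x * binom_mean n x (\<lambda>k. 1 / real (Suc k)) =
      binom_mean (Suc n) x (\<lambda>k. real k * (1 / real k))"
    by (simp only: binom_mean_size_bias[of n x "\<lambda>k. 1 / real k"])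
  also have "\<dots> \<le> binom_mean (Suc n) x (\<lambda>k. 1)"
    by (rule binom_mean_mono) (use assms in auto)
  finally have "real (Suc n) * x * binom_mean n x (\<lambda>k. 1 / real (Suc k)) \<le> 1"
    by simp
  moreover have "0 < real (Suc n) * x" using assms by simp
  ultimately show ?thesis
    by (simp only: pos_le_divide_eq mult.commute)
qed

section \<open>The bias of a single symbol\<close>

definition xlnx :: "real \<Rightarrow> real"
  where "xlnx t = t * ln t"

definition xlnx_step :: "nat \<Rightarrow> real"
  where "xlnx_step k = xlnx (real (Suc k)) - xlnx (real k)"

lemma xlnx_step_eq:
  "xlnx_step k = ln (real (Suc k)) + real k * (ln (real (Suc k)) - ln (real k))"
  by (simp add: xlnx_step_def xlnx_def algebra_simps)

lemma xlnx_step_le: "xlnx_step k \<le> ln (real (Suc k)) + 1"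
proof (cases "k = 0")
  case False
  have "ln (real (Suc k) / real k) \<le> real (Suc k) / real k - 1"
    by (rule ln_le_minus_one) (use False in auto)
  then have "ln (real (Suc k)) - ln (real k) \<le> 1 / real k"
    using False by (simp add: ln_div field_simps)
  then have "real k * (ln (real (Suc k)) - ln (real k)) \<le> 1"
    using False by (simp add: field_simps)
  then show ?thesis by (simp add: xlnx_step_eq)
qed (simp add: xlnx_step_eq)

lemma xlnx_step_ge: "ln (real (Suc k)) + 1 - 1 / real (Suc k) \<le> xlnx_step k"
proof (cases "k = 0")
  case False
  have "ln (real k / real (Suc k)) \<le> real k / real (Suc k) - 1"
    by (rule ln_le_minus_one) (use False in auto)
  then have "1 / real (Suc k) \<le> ln (real (Suc k)) - ln (real k)"
    using False by (simp add: ln_div field_simps)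
  then have "real k * (1 / real (Suc k)) \<le> real k * (ln (real (Suc k)) - ln (real k))"
    by (rule mult_left_mono) auto
  moreover have "real k * (1 / real (Suc k)) = 1 - 1 / real (Suc k)"
    by (simp add: field_simps)
  ultimately show ?thesis by (simp add: xlnx_step_eq)
qed (simp add: xlnx_step_eq)

lemma xlnx_step_bounds: "0 \<le> xlnx_step k" "xlnx_step k \<le> real (Suc k)"
proof -
  have "0 \<le> ln (real (Suc k)) + (1 - 1 / real (Suc k))"
    by (intro add_nonneg_nonneg) (auto simp: field_simps)
  then show "0 \<le> xlnx_step k"
    using xlnx_step_ge[of k] by linarith
  show "xlnx_step k \<le> real (Suc k)"
    using xlnx_step_le[of k] ln_le_minus_one[of "real (Suc k)"] by simp
qed

text \<open>
  The function \<open>h\<^sub>n\<close>. At \<open>y = n p\<^sub>j\<close> it is \<open>n\<close> times the share of the symbol \<open>j\<close> in the amount by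
  which the estimator falls short of the entropy on average. Its derivative is \<open>bias_deriv\<close>.
\<close>
definition bias_fun :: "nat \<Rightarrow> real \<Rightarrow> real"
  where "bias_fun n y = binom_mean n (y / real n) (\<lambda>k. xlnx (real k)) - xlnx y"

definition bias_deriv :: "nat \<Rightarrow> real \<Rightarrow> real"
  where "bias_deriv n y = binom_mean (n - 1) (y / real n) xlnx_step - ln y - 1"

lemma bias_fun_has_derivative:
  assumes "n \<ge> 1" "y > 0"
  shows "(bias_fun n has_real_derivative bias_deriv n y) (at y)"
proof -
  obtain m where n: "n = Suc m" using assms by (cases n) auto
  have 1: "((\<lambda>y. binom_mean n (y / real n) (\<lambda>k. xlnx (real k))) has_real_derivative
      (real n * binom_mean m (y / real n) xlnx_step) * (1 / real n)) (at y)"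
    unfolding n xlnx_step_def
    by (rule DERIV_chain'[OF _ has_real_derivative_binom_mean]) (auto intro!: derivative_eq_intros)
  have 2: "(xlnx has_real_derivative ln y + 1) (at y)"
    unfolding xlnx_def[abs_def] using assms by (auto intro!: derivative_eq_intros)
  show ?thesis
    unfolding bias_fun_def[abs_def]
    by (rule DERIV_cong[OF DERIV_diff[OF 1 2]]) (use n in \<open>auto simp: bias_deriv_def\<close>)
qed

text \<open>
  Up to an error of at most \<open>1 / (B + 1)\<close>, the increment \<open>xlnx_step B\<close> is \<open>ln (B + 1) + 1\<close>. So
  the derivative differs from \<open>E ln ((B + 1) / y)\<close>, which lies in \<open>[0, 1 / y]\<close>, by at most
  \<open>E (1 / (B + 1)) \<le> 1 / y\<close>, and the two contributions have opposite signs. The second bound serves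
  near \<open>0\<close>, where \<open>ln y\<close> is the dominant term.
\<close>
lemma bias_deriv_bounds:
  assumes "n \<ge> 1" "y > 0" "y \<le> real n"
  shows "\<bar>bias_deriv n y\<bar> \<le> 1 / y"
    and "\<bar>bias_deriv n y\<bar> \<le> 1 + y + \<bar>ln y\<bar>"
    and binom_mean_ln_ge: "ln y \<le> binom_mean (n - 1) (y / real n) (\<lambda>k. ln (real (Suc k)))"
proof -
  obtain m where n: "n = Suc m" using assms by (cases n) auto
  define E where "E = binom_mean m (y / real n)"
  define A where "A = E (\<lambda>k. ln (real (Suc k)))"
  define R where "R = E (\<lambda>k. 1 / real (Suc k))"
  have x: "0 \<le> y / real n" "y / real n \<le> 1" "0 < y / real n" using assms by auto
  have mono: "(\<And>k. f k \<le> g k) \<Longrightarrow> E f \<le> E g" for f g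
    unfolding E_def by (rule binom_mean_mono[OF x(1,2)])
  have R: "R \<le> 1 / y"
    using binom_mean_inverse_Suc_le[OF x(3,2), of m] assms(1) by (simp add: R_def E_def n)
  have mean: "E real \<le> y"
    unfolding E_def binom_mean_of_nat using assms by (simp add: n field_simps)
  \<comment> \<open>the two halves of \<open>1 - 1/t \<le> ln t \<le> t - 1\<close> at \<open>t = (k + 1) / y\<close>\<close>
  have "E (\<lambda>k. (1 + ln y) - y * (1 / real (Suc k))) \<le> A"
    unfolding A_def
  proof (rule mono)
    fix k
    have "ln (y / real (Suc k)) \<le> y / real (Suc k) - 1"
      by (rule ln_le_minus_one) (use assms in auto)
    then show "(1 + ln y) - y * (1 / real (Suc k)) \<le> ln (real (Suc k))"
      using assms by (simp add: ln_div)
  qed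
  then have "1 + ln y - y * R \<le> A"
    by (simp only: E_def R_def binom_mean_diff binom_mean_cmult binom_mean_const)
  moreover have "y * R \<le> 1"
    using R assms by (simp add: field_simps)
  ultimately have A1: "ln y \<le> A" by simp
  then show "ln y \<le> binom_mean (n - 1) (y / real n) (\<lambda>k. ln (real (Suc k)))"
    by (simp add: A_def E_def n)
  have "A \<le> E (\<lambda>k. (1 / y) * real k + (1 / y + ln y - 1))"
    unfolding A_def
  proof (rule mono)
    fix k
    have "ln (real (Suc k) / y) \<le> real (Suc k) / y - 1"
      by (rule ln_le_minus_one) (use assms in auto)
    moreover have "ln (real (Suc k) / y) = ln (real (Suc k)) - ln y"
      using assms by (simp add: ln_div del: of_nat_Suc)
    moreover have "real (Suc k) / y = (1 / y) * real k + 1 / y"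
      by (simp add: add_divide_distrib)
    ultimately show "ln (real (Suc k)) \<le> (1 / y) * real k + (1 / y + ln y - 1)"
      by linarith
  qed
  also have "\<dots> = (1 / y) * E real + (1 / y + ln y - 1)"
    unfolding E_def by (simp only: binom_mean_add binom_mean_cmult binom_mean_const)
  also have "(1 / y) * E real \<le> (1 / y) * y"
    by (rule mult_left_mono[OF mean]) (use assms in auto)
  finally have A2: "A \<le> ln y + 1 / y" using assms by simp
  have "A \<le> E real"
    unfolding A_def 
  proof (rule mono)
    fix k show "ln (real (Suc k)) \<le> real k"
      using ln_add_one_self_le_self[of "real k"] by (simp add: add.commute)
  qed
  then have A3: "A \<le> y" using mean by simp
  have "E xlnx_step \<le> E (\<lambda>k. ln (real (Suc k)) + 1)"
    by (rule mono[OF xlnx_step_le])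
  then have S1: "E xlnx_step \<le> A + 1"
    by (simp add: E_def A_def binom_mean_add del: of_nat_Suc)
  have "E (\<lambda>k. ln (real (Suc k)) + 1 - 1 / real (Suc k)) \<le> E xlnx_step"
    by (rule mono[OF xlnx_step_ge])
  then have S2: "A + 1 - R \<le> E xlnx_step"
    by (simp add: E_def A_def R_def binom_mean_add binom_mean_diff del: of_nat_Suc)
  have "E (\<lambda>k. 0) \<le> E xlnx_step"
    by (rule mono[OF xlnx_step_bounds(1)])
  then have S3: "0 \<le> E xlnx_step" by (simp add: E_def)
  have d: "bias_deriv n y = E xlnx_step - ln y - 1"
    by (simp add: bias_deriv_def E_def n)
  show "\<bar>bias_deriv n y\<bar> \<le> 1 / y"
    unfolding d using A1 A2 S1 S2 R by linarith
  show "\<bar>bias_deriv n y\<bar> \<le> 1 + y + \<bar>ln y\<bar>"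
    unfolding d using A3 S1 S3 assms(2) by linarith
qed

lemma bias_fun_eq:
  assumes "n \<ge> 1"
  shows "bias_fun n y = y * (binom_mean (n - 1) (y / real n) (\<lambda>k. ln (real (Suc k))) - ln y)"
proof -
  obtain m where n: "n = Suc m" using assms by (cases n) auto
  have "binom_mean n (y / real n) (\<lambda>k. real k * ln (real k)) =
      y * binom_mean m (y / real n) (\<lambda>k. ln (real (Suc k)))"
    unfolding n binom_mean_size_bias by simp
  then show ?thesis
    by (simp add: bias_fun_def xlnx_def n algebra_simps)
qed

section \<open>The Poisson limit\<close>

definition poisson_weight :: "real \<Rightarrow> nat \<Rightarrow> real"
  where "poisson_weight y k = y ^ k / fact k * exp (- y)"

lemma Suc_le_power2: "real (Suc k) \<le> 2 ^ k"
proof -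
  have "Suc k \<le> 2 ^ k" using Suc_leI[OF less_exp[of k]] .
  then have "real (Suc k) \<le> real (2 ^ k)" by (simp only: of_nat_le_iff)
  then show ?thesis by simp
qed

lemma summable_poisson_weight:
  assumes "\<And>k. \<bar>f k\<bar> \<le> c * 4 ^ k"
  shows "summable (\<lambda>k. \<bar>poisson_weight y k * f k\<bar>)"
proof (rule summable_comparison_test')
  show "summable (\<lambda>k. c * exp (- y) * ((4 * \<bar>y\<bar>) ^ k / fact k))"
    using summable_exp[of "4 * \<bar>y\<bar>"] by (intro summable_mult) (simp add: field_simps)
  fix k :: nat
  have "\<bar>poisson_weight y k * f k\<bar> = \<bar>y\<bar> ^ k / fact k * exp (- y) * \<bar>f k\<bar>"
    by (simp add: poisson_weight_def abs_mult power_abs)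
  also have "\<dots> \<le> \<bar>y\<bar> ^ k / fact k * exp (- y) * (c * 4 ^ k)"
    by (intro mult_left_mono assms) auto
  finally show "norm \<bar>poisson_weight y k * f k\<bar> \<le> c * exp (- y) * ((4 * \<bar>y\<bar>) ^ k / fact k)"
    by (simp add: power_mult_distrib field_simps)
qed

lemma expectation_poisson:
  fixes f :: "nat \<Rightarrow> real"
  assumes "y > 0" "\<And>k. \<bar>f k\<bar> \<le> c * 4 ^ k"
  shows "measure_pmf.expectation (poisson_pmf y) f = (\<Sum>k. poisson_weight y k * f k)"
proof -
  have "measure_pmf.expectation (poisson_pmf y) f = (\<integral>k. poisson_weight y k * f k \<partial>count_space UNIV)"
    unfolding measure_pmf_eq_density
    by (subst integral_real_density) (use assms(1) in \<open>auto simp: poisson_weight_def AE_count_space\<close>)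
  also have "\<dots> = (\<Sum>k. poisson_weight y k * f k)"
    by (rule integral_count_space_nat)
      (simp add: integrable_count_space_nat_iff summable_poisson_weight[OF assms(2)])
  finally show ?thesis .
qed

lemma poisson_weight_Suc: "real (Suc k) * poisson_weight y (Suc k) = y * poisson_weight y k"
  by (simp add: poisson_weight_def field_simps del: of_nat_Suc)

text \<open>
  \<open>psi\<close> has the same shape as \<open>bias_deriv\<close>, with the Poisson law in place of the binomial one.
  The two expressions agree because size biasing merely shifts the Poisson law by one, so that
  \<open>E (P ln P) = y E (ln (P + 1))\<close>.
\<close>
lemma psi_eq_suminf:
  assumes "y > 0"
  shows "psi y = (\<Sum>k. poisson_weight y k * xlnx_step k) - ln y - 1"
proof -
  let ?w = "poisson_weight y"
  have ln_le: "\<bar>ln (real k + 1)\<bar> \<le> real k" for k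
    using ln_add_one_self_le_self[of "real k"] by (simp add: add.commute)
  have le2: "real k \<le> 2 ^ k" "real k + 1 \<le> 2 ^ k" for k
    using Suc_le_power2[of k] by auto
  have b1: "\<bar>(real k + 1) * ln (real k + 1)\<bar> \<le> 1 * 4 ^ k" for k
  proof -
    have "\<bar>(real k + 1) * ln (real k + 1)\<bar> \<le> 2 ^ k * 2 ^ k"
      unfolding abs_mult by (intro mult_mono) (use ln_le[of k] le2[of k] in auto)
    also have "\<dots> = (4::real) ^ k" by (simp flip: power_mult_distrib)
    finally show ?thesis by simp
  qed
  have b2: "\<bar>ln (real k + 1)\<bar> \<le> 1 * 4 ^ k" for k
  proof -
    have "\<bar>ln (real k + 1)\<bar> \<le> 2 ^ k" using ln_le[of k] le2[of k] by simp
    also have "\<dots> \<le> (4::real) ^ k" by (rule power_mono) auto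
    finally show ?thesis by simp
  qed
  have b3: "\<bar>(real k + 1 - y) * ln (real k + 1)\<bar> \<le> (1 + y) * 4 ^ k" for k
  proof -
    have "\<bar>(real k + 1 - y) * ln (real k + 1)\<bar> =
        \<bar>(real k + 1) * ln (real k + 1) - y * ln (real k + 1)\<bar>"
      by (simp add: algebra_simps)
    also have "\<dots> \<le> \<bar>(real k + 1) * ln (real k + 1)\<bar> + \<bar>y * ln (real k + 1)\<bar>"
      by (rule abs_triangle_ineq4)
    also have "\<bar>y * ln (real k + 1)\<bar> \<le> y * 4 ^ k"
      unfolding abs_mult using assms b2[of k] by (intro mult_mono) auto
    also have "\<bar>(real k + 1) * ln (real k + 1)\<bar> \<le> 4 ^ k" using b1[of k] by simp
    finally show ?thesis by (simp add: algebra_simps)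
  qed
  have s1: "summable (\<lambda>k. ?w k * ((real k + 1) * ln (real k + 1)))"
    by (rule summable_rabs_cancel[OF summable_poisson_weight[OF b1]])
  have s2: "summable (\<lambda>k. ?w k * ln (real k + 1))"
    by (rule summable_rabs_cancel[OF summable_poisson_weight[OF b2]])
  have shift: "?w (Suc k) * xlnx (real (Suc k)) = y * (?w k * ln (real k + 1))" for k
  proof -
    have "?w (Suc k) * xlnx (real (Suc k)) = (real (Suc k) * ?w (Suc k)) * ln (real (Suc k))"
      by (simp add: xlnx_def)
    then show ?thesis unfolding poisson_weight_Suc by (simp add: add.commute)
  qed
  have "(\<lambda>k. y * (?w k * ln (real k + 1))) sums (y * (\<Sum>k. ?w k * ln (real k + 1)))"
    by (intro sums_mult summable_sums s2)
  then have "(\<lambda>k. ?w (Suc k) * xlnx (real (Suc k))) sums (y * (\<Sum>k. ?w k * ln (real k + 1)))"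
    by (simp only: shift)
  then have k_sums: "(\<lambda>k. ?w k * xlnx (real k)) sums (y * (\<Sum>k. ?w k * ln (real k + 1)))"
    using sums_Suc_iff[of "\<lambda>k. ?w k * xlnx (real k)"] by (simp add: xlnx_def)
  have "(\<lambda>k. ?w k * ((real k + 1) * ln (real k + 1)) - ?w k * xlnx (real k)) sums
     ((\<Sum>k. ?w k * ((real k + 1) * ln (real k + 1))) - y * (\<Sum>k. ?w k * ln (real k + 1)))"
    by (intro sums_diff summable_sums s1 k_sums)
  then have A: "(\<Sum>k. ?w k * xlnx_step k) =
     (\<Sum>k. ?w k * ((real k + 1) * ln (real k + 1))) - y * (\<Sum>k. ?w k * ln (real k + 1))"
    by (intro sums_unique[symmetric]) (simp add: xlnx_step_def xlnx_def algebra_simps)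
  have "(\<lambda>k. ?w k * ((real k + 1) * ln (real k + 1)) - y * (?w k * ln (real k + 1))) sums
     ((\<Sum>k. ?w k * ((real k + 1) * ln (real k + 1))) - y * (\<Sum>k. ?w k * ln (real k + 1)))"
    by (intro sums_diff summable_sums s1 sums_mult s2)
  then have "(\<Sum>k. ?w k * ((real k + 1 - y) * ln (real k + 1))) =
     (\<Sum>k. ?w k * ((real k + 1) * ln (real k + 1))) - y * (\<Sum>k. ?w k * ln (real k + 1))"
    by (intro sums_unique[symmetric]) (simp add: algebra_simps)
  with A show ?thesis
    unfolding psi_def by (subst expectation_poisson[OF _ b3]) (use assms in auto)
qed

text \<open>
  Induction on \<open>k\<close>: the ratios of consecutive weights converge, which avoids any asymptotics of
  binomial coefficients.
\<close>
lemma Bernstein_tendsto_poisson: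
  "(\<lambda>m. Bernstein m k (y / real (Suc m))) \<longlonglongrightarrow> poisson_weight y k"
proof (induction k)
  case 0
  have "(\<lambda>m. (1 - y / real (Suc m)) ^ m) \<longlonglongrightarrow> exp (- y)"
    by real_asymp
  then show ?case by (simp add: Bernstein_def[abs_def] poisson_weight_def del: of_nat_Suc binomial_n_0)
      (simp only: binomial_n_0 of_nat_1 mult_1)
next
  case (Suc k)
  let ?x = "\<lambda>m. y / real (Suc m)"
  have "(\<lambda>m. (real m - real k) / real (Suc k) * (?x m / (1 - ?x m))) \<longlonglongrightarrow> inverse (1 + real k) * y"
    by real_asymp
  also have "inverse (1 + real k) * y = y / real (Suc k)"
    by (simp add: field_simps)
  finally have lim: "(\<lambda>m. Bernstein m k (?x m) *
      ((real m - real k) / real (Suc k) * (?x m / (1 - ?x m)))) \<longlonglongrightarrow>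
      poisson_weight y k * (y / real (Suc k))"
    by (intro tendsto_mult Suc.IH)
  have "\<forall>\<^sub>F m in sequentially. ?x m < 1"
    by real_asymp
  then have "\<forall>\<^sub>F m in sequentially. 1 - ?x m \<noteq> 0 \<and> k < m"
    using eventually_gt_at_top[of k] by eventually_elim auto
  then have ev: "\<forall>\<^sub>F m in sequentially. Bernstein m k (?x m) *
      ((real m - real k) / real (Suc k) * (?x m / (1 - ?x m))) = Bernstein m (Suc k) (?x m)"
  proof eventually_elim
    case (elim m)
    define x where "x = ?x m"
    have "Suc k * (m choose Suc k) = (m - k) * (m choose k)"
      by (metis binomial_absorb_comp binomial_absorption mult.commute)
    then have "real (Suc k * (m choose Suc k)) = real ((m - k) * (m choose k))"
      by (rule arg_cong)
    then have c: "real (Suc k) * real (m choose Suc k) = (real m - real k) * real (m choose k)"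
      using elim by (simp only: of_nat_mult) (simp add: of_nat_diff)
    have "m - k = Suc (m - Suc k)" using elim by (simp only: Suc_diff_Suc)
    then have pow: "(1 - x) ^ (m - k) = (1 - x) * (1 - x) ^ (m - Suc k)" by simp
    have "Bernstein m k x * ((real m - real k) / real (Suc k) * (x / (1 - x))) =
      ((real m - real k) * real (m choose k)) / real (Suc k) * (x * x ^ k) *
        ((1 - x) ^ (m - k) / (1 - x))"
      by (simp add: Bernstein_def)
    also have "\<dots> = Bernstein m (Suc k) x"
      unfolding c[symmetric] pow using elim by (simp add: Bernstein_def x_def del: of_nat_Suc)
    finally show ?case by (simp only: x_def)
  qed
  have "poisson_weight y k * (y / real (Suc k)) = poisson_weight y (Suc k)"
    using poisson_weight_Suc[of k y] by (simp add: field_simps del: of_nat_Suc)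
  with Lim_transform_eventually[OF lim ev] show ?case by simp
qed

lemma Bernstein_le:
  assumes "0 \<le> x" "x \<le> 1"
  shows "Bernstein m k x \<le> (real m * x) ^ k / fact k"
proof -
  have "real ((m choose k) * fact k) \<le> real (m ^ k)"
    by (simp only: of_nat_le_iff binomial_fact_pow)
  then have "real (m choose k) \<le> real m ^ k / fact k"
    by (simp add: field_simps)
  then have "Bernstein m k x \<le> (real m ^ k / fact k) * x ^ k * 1"
    unfolding Bernstein_def using assms
    by (intro mult_mono power_le_one) auto
  then show ?thesis by (simp add: power_mult_distrib)
qed

text \<open>
  The majorant from \<open>Bernstein_le\<close> is independent of the number of trials and outweighs the
  growth of \<open>xlnx_step\<close>, so Tannery's theorem gives the limit term by term.
\<close>
lemma bias_deriv_tendsto_psi: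
  assumes "y > 0"
  shows "(\<lambda>n. bias_deriv n y) \<longlonglongrightarrow> psi y"
proof -
  define a where "a k m = Bernstein m k (y / real (Suc m)) * xlnx_step k" for k m
  have suminf_a: "(\<Sum>k. a k m) = binom_mean m (y / real (Suc m)) xlnx_step" for m
    unfolding binom_mean_def a_def by (rule suminf_finite) (auto simp: Bernstein_def)
  define B where "B k = y ^ k / fact k * 2 ^ k" for k
  have bound: "norm (a k m) \<le> B k" if "y \<le> real (Suc m)" for k m
  proof -
    let ?x = "y / real (Suc m)"
    have x: "0 \<le> ?x" "?x \<le> 1" using that assms by auto
    have "Bernstein m k ?x \<le> (real m * ?x) ^ k / fact k"
      by (rule Bernstein_le[OF x])
    also have "\<dots> \<le> y ^ k / fact k"
      by (intro divide_right_mono power_mono) (use assms in \<open>auto simp: field_simps\<close>)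
    finally have "Bernstein m k ?x * xlnx_step k \<le> y ^ k / fact k * 2 ^ k"
      using order_trans[OF xlnx_step_bounds(2) Suc_le_power2, of k] xlnx_step_bounds(1)[of k] assms
      by (intro mult_mono) auto
    then show ?thesis
      unfolding a_def B_def using Bernstein_nonneg[OF x, of m k] xlnx_step_bounds(1)[of k]
      by (simp add: abs_mult)
  qed
  have "(\<lambda>m. (\<Sum>k. a k m)) \<longlonglongrightarrow> (\<Sum>k. poisson_weight y k * xlnx_step k)"
  proof (rule tannerys_theorem[THEN conjunct2, THEN conjunct2])
    show "(\<lambda>m. a k m) \<longlonglongrightarrow> poisson_weight y k * xlnx_step k" for k
      unfolding a_def by (intro tendsto_intros Bernstein_tendsto_poisson)
    have "\<forall>\<^sub>F m in sequentially. y \<le> real (Suc m)" by real_asymp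
    then show "\<forall>\<^sub>F (k, m) in at_top \<times>\<^sub>F sequentially. norm (a k m) \<le> B k"
      unfolding eventually_prod_filter
      by (intro exI[of _ "\<lambda>_. True"] exI[of _ "\<lambda>m. y \<le> real (Suc m)"]) (use bound in auto)
    show "summable B"
      using summable_exp[of "2 * y"] by (simp add: B_def[abs_def] power_mult_distrib field_simps)
  qed auto
  then have "(\<lambda>m. bias_deriv (Suc m) y) \<longlonglongrightarrow> psi y"
    unfolding suminf_a psi_eq_suminf[OF assms] bias_deriv_def diff_Suc_1
    by (intro tendsto_intros)
  then show ?thesis
    by (rule LIMSEQ_imp_Suc)
qed

section \<open>Potter bounds\<close>

text \<open>
  For a monotone function it suffices to control doublings: iterate up to the power of two next
  above \<open>l\<close>. The factor \<open>2\<close> in the bound pays for rounding \<open>l\<close> to a power of two. The lower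
  bound below is analogous.
\<close>
lemma potter_upper:
  fixes U :: "real \<Rightarrow> real"
  assumes mono: "\<And>s t. 0 < s \<Longrightarrow> s \<le> t \<Longrightarrow> U s \<le> U t"
    and doubling: "\<And>t. t \<ge> T \<Longrightarrow> U (2 * t) \<le> 2 powr \<beta> * U t"
    and "T > 0" "\<beta> > 0" "t \<ge> T" "l \<ge> 1" "U t \<ge> 0"
  shows "U (l * t) \<le> (2 * l) powr \<beta> * U t"
proof -
  have iter: "U (2 ^ k * t) \<le> (2 ^ k) powr \<beta> * U t" for k
  proof (induction k)
    case (Suc k)
    have "1 * T \<le> 2 ^ k * t" using assms by (intro mult_mono) auto
    then have "U (2 * (2 ^ k * t)) \<le> 2 powr \<beta> * U (2 ^ k * t)" by (intro doubling) simp
    also have "\<dots> \<le> 2 powr \<beta> * ((2 ^ k) powr \<beta> * U t)" by (intro mult_left_mono Suc.IH) auto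
    finally show ?case by (simp add: powr_mult mult_ac)
  qed simp
  define k where "k = nat \<lceil>log 2 l\<rceil>"
  have lk: "real k \<ge> log 2 l" "real k \<le> log 2 l + 1"
    using assms by (auto simp: k_def)
  have le1: "l \<le> 2 ^ k"
    using lk(1) assms by (simp add: log_le_iff powr_realpow)
  have "2 powr real k \<le> 2 powr (log 2 l + 1)" using lk(2) by (rule powr_mono) simp
  then have le2: "2 ^ k \<le> 2 * l"
    using assms by (simp add: powr_add powr_realpow)
  have "U (l * t) \<le> U (2 ^ k * t)"
    by (rule mono) (use assms le1 in auto)
  also have "\<dots> \<le> (2 ^ k) powr \<beta> * U t" by (rule iter)
  also have "\<dots> \<le> (2 * l) powr \<beta> * U t"
    by (intro mult_right_mono powr_mono2) (use assms le2 in auto)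
  finally show ?thesis .
qed

lemma potter_lower:
  fixes U :: "real \<Rightarrow> real"
  assumes mono: "\<And>s t. 0 < s \<Longrightarrow> s \<le> t \<Longrightarrow> U s \<le> U t"
    and doubling: "\<And>t. t \<ge> T \<Longrightarrow> 2 powr \<beta> * U t \<le> U (2 * t)"
    and "T > 0" "\<beta> > 0" "t \<ge> T" "l \<ge> 1" "U t \<ge> 0"
  shows "(l / 2) powr \<beta> * U t \<le> U (l * t)"
proof -
  have iter: "(2 ^ k) powr \<beta> * U t \<le> U (2 ^ k * t)" for k
  proof (induction k)
    case (Suc k)
    have "1 * T \<le> 2 ^ k * t" using assms by (intro mult_mono) auto
    then have d: "2 powr \<beta> * U (2 ^ k * t) \<le> U (2 * (2 ^ k * t))" by (intro doubling) simp
    have "2 powr \<beta> * ((2 ^ k) powr \<beta> * U t) \<le> 2 powr \<beta> * U (2 ^ k * t)"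
      by (intro mult_left_mono Suc.IH) auto
    also note d
    finally show ?case by (simp add: powr_mult mult_ac)
  qed simp
  define k where "k = nat \<lfloor>log 2 l\<rfloor>"
  have "0 \<le> log 2 l" using assms by simp
  then have lk: "real k \<le> log 2 l" "real k \<ge> log 2 l - 1"
    by (auto simp: k_def)
  have le1: "2 ^ k \<le> l"
    using lk(1) assms by (simp add: le_log_iff powr_realpow)
  have "2 powr (log 2 l - 1) \<le> 2 powr real k" using lk(2) by (rule powr_mono) simp
  then have le2: "l / 2 \<le> 2 ^ k"
    using assms by (simp add: powr_diff powr_realpow)
  have "(l / 2) powr \<beta> * U t \<le> (2 ^ k) powr \<beta> * U t"
    by (intro mult_right_mono powr_mono2) (use assms le2 in auto)
  also have "\<dots> \<le> U (2 ^ k * t)" by (rule iter)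
  also have "\<dots> \<le> U (l * t)"
    by (rule mono) (use assms le1 in auto)
  finally show ?thesis .
qed

text \<open>
  The second bound is claimed for all \<open>y\<close> up to \<open>t\<close>, where \<open>t / y\<close> drops below the threshold of
  the asymptotic regime. There monotonicity allows to compare with the value at the threshold
  itself, at the cost of a constant depending on the threshold.
\<close>
lemma potter_bounds:
  fixes U :: "real \<Rightarrow> real"
  assumes mono: "\<And>s t. 0 < s \<Longrightarrow> s \<le> t \<Longrightarrow> U s \<le> U t"
    and nonneg: "\<And>t. U t \<ge> 0" and pos: "\<forall>\<^sub>F t in at_top. U t > 0"
    and lim: "((\<lambda>t. U (2 * t) / U t) \<longlongrightarrow> 2 powr \<alpha>) at_top"
    and \<delta>: "0 < \<delta>" "\<delta> < \<alpha>"
  obtains T K where "T \<ge> 1" "K > 0"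
    "\<And>t y. t \<ge> T \<Longrightarrow> 0 < y \<Longrightarrow> y \<le> 1 \<Longrightarrow> U (t / y) \<le> K * y powr (- \<alpha> - \<delta>) * U t"
    "\<And>t y. t \<ge> T \<Longrightarrow> 1 \<le> y \<Longrightarrow> y \<le> t \<Longrightarrow> U (t / y) \<le> K * y powr (\<delta> - \<alpha>) * U t"
proof -
  have "2 powr \<alpha> < 2 powr (\<alpha> + \<delta>)" "2 powr (\<alpha> - \<delta>) < 2 powr \<alpha>" using \<delta> by auto
  then have "\<forall>\<^sub>F t in at_top. U (2 * t) / U t < 2 powr (\<alpha> + \<delta>)"
    "\<forall>\<^sub>F t in at_top. 2 powr (\<alpha> - \<delta>) < U (2 * t) / U t"
    using order_tendstoD[OF lim] by auto
  with pos have "\<forall>\<^sub>F t in at_top. U (2 * t) \<le> 2 powr (\<alpha> + \<delta>) * U t \<and>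
      2 powr (\<alpha> - \<delta>) * U t \<le> U (2 * t)"
    by eventually_elim (auto simp: field_simps)
  then obtain T0 where T0: "\<And>t. t \<ge> T0 \<Longrightarrow> U (2 * t) \<le> 2 powr (\<alpha> + \<delta>) * U t"
      "\<And>t. t \<ge> T0 \<Longrightarrow> 2 powr (\<alpha> - \<delta>) * U t \<le> U (2 * t)"
    unfolding eventually_at_top_linorder by blast
  define T where "T = max T0 1"
  have T: "T \<ge> 1" "T > 0" by (auto simp: T_def)
  have up: "U (l * t) \<le> (2 * l) powr (\<alpha> + \<delta>) * U t" if "t \<ge> T" "l \<ge> 1" for t l
    by (rule potter_upper[where U = U and T = T, OF mono _ T(2)]) (use that \<delta> nonneg T0 in \<open>auto simp: T_def\<close>)
  have lo: "(l / 2) powr (\<alpha> - \<delta>) * U t \<le> U (l * t)" if "t \<ge> T" "l \<ge> 1" for t l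
    by (rule potter_lower[where U = U and T = T, OF mono _ T(2)]) (use that \<delta> nonneg T0 in \<open>auto simp: T_def\<close>)
  define K where "K = max (2 powr (\<alpha> + \<delta>)) ((2 * T) powr (\<alpha> - \<delta>))"
  show thesis
  proof
    show "T \<ge> 1" "K > 0" using T by (auto simp: K_def less_max_iff_disj)
    fix t y :: real
    { assume *: "t \<ge> T" "0 < y" "y \<le> 1"
      have "U (1 / y * t) \<le> (2 * (1 / y)) powr (\<alpha> + \<delta>) * U t"
        by (rule up) (use * in auto)
      also have "(2 * (1 / y)) powr (\<alpha> + \<delta>) = 2 powr (\<alpha> + \<delta>) * y powr (- \<alpha> - \<delta>)"
      proof -
        have "y powr (- \<alpha> - \<delta>) = y powr (- (\<alpha> + \<delta>))" by simp
        also have "\<dots> = 1 / y powr (\<alpha> + \<delta>)" by (rule powr_minus_divide)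
        finally show ?thesis using * by (simp add: powr_divide)
      qed
      also have "\<dots> * U t \<le> K * y powr (- \<alpha> - \<delta>) * U t"
        by (intro mult_right_mono) (auto simp: K_def nonneg)
      finally show "U (t / y) \<le> K * y powr (- \<alpha> - \<delta>) * U t" by simp }
    { assume *: "t \<ge> T" "1 \<le> y" "y \<le> t"
      \<comment> \<open>the comparison point: \<open>t / y\<close> itself, or the threshold \<open>T\<close> if \<open>t / y\<close> is below it\<close>
      define s where "s = max (t / y) T"
      have s: "s \<ge> T" "s > 0" "t / y \<le> s" using T by (auto simp: s_def)
      have "s \<le> t" using * T by (auto simp: s_def field_simps) 
      then have l: "t / s \<ge> 1" using s by simp
      have ys: "s \<le> T * (t / y)"
        using * T mult_left_mono[of 1 "t / y" T] mult_right_mono[of 1 T "t / y"] by (auto simp: s_def)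
      then have "s * y \<le> T * t" using * by (simp add: field_simps)
      then have yT: "y / (2 * T) \<le> t / s / 2" using s T by (simp add: field_simps)
      have "(y / (2 * T)) powr (\<alpha> - \<delta>) * U s \<le> (t / s / 2) powr (\<alpha> - \<delta>) * U s"
        by (intro mult_right_mono powr_mono2) (use \<delta> yT nonneg * T in auto)
      also have "\<dots> \<le> U (t / s * s)"
        by (rule lo[OF s(1) l])
      finally have b: "(y / (2 * T)) powr (\<alpha> - \<delta>) * U s \<le> U t" using s by simp
      have "U (t / y) \<le> U s" by (rule mono) (use * s T in auto)
      also have "U s = ((2 * T) powr (\<alpha> - \<delta>) * y powr (\<delta> - \<alpha>)) *
          ((y / (2 * T)) powr (\<alpha> - \<delta>) * U s)"
      proof -
        have "(2 * T) powr (\<alpha> - \<delta>) * y powr (\<delta> - \<alpha>) * (y / (2 * T)) powr (\<alpha> - \<delta>) =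
            (2 * T) powr (\<alpha> - \<delta>) / (2 * T) powr (\<alpha> - \<delta>) * (y powr (\<delta> - \<alpha>) * y powr (\<alpha> - \<delta>))"
          using * T by (simp add: powr_divide)
        also have "\<dots> = 1" using * T by (simp flip: powr_add)
        finally show ?thesis by (simp flip: mult.assoc)
      qed
      also have "\<dots> \<le> ((2 * T) powr (\<alpha> - \<delta>) * y powr (\<delta> - \<alpha>)) * U t"
        by (rule mult_left_mono[OF b]) auto
      also have "\<dots> \<le> K * y powr (\<delta> - \<alpha>) * U t"
        by (intro mult_right_mono) (auto simp: K_def nonneg)
      finally show "U (t / y) \<le> K * y powr (\<delta> - \<alpha>) * U t" . }
  qed
qed

section \<open>Integrability of powers\<close>

lemma integrable_lborel_nonneg:
  fixes f :: "real \<Rightarrow> real"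
  assumes "f integrable_on A" "A \<in> sets borel" "f \<in> borel_measurable borel"
    "\<And>x. x \<in> A \<Longrightarrow> 0 \<le> f x"
  shows "integrable lborel (\<lambda>x. indicator A x * f x)"
proof -
  have "integrable lebesgue (\<lambda>x. indicator A x * f x)"
    using nonnegative_absolutely_integrable_1[OF assms(1,4)] by (simp add: set_integrable_def)
  moreover have "(\<lambda>x. indicator A x * f x) \<in> borel_measurable lborel"
    using assms(2,3) by simp
  ultimately show ?thesis by (simp add: integrable_completion)
qed

lemma integrable_powr_near_0:
  fixes a :: real assumes "a > -1"
  shows "integrable lborel (\<lambda>x. indicator {0<..1} x * x powr a)"
  by (rule integrable_lborel_nonneg) (use integrable_on_powr_from_0'[OF assms, of 1] in auto)

lemma integrable_powr_near_infinity:
  fixes a :: real assumes "a < -1"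
  shows "integrable lborel (\<lambda>x. indicator {1..} x * x powr a)"
proof (rule integrable_lborel_nonneg)
  show "(\<lambda>x. x powr a) integrable_on {1..}"
    using has_integral_powr_to_inf[OF assms, of 1] by (auto simp: integrable_on_def)
qed auto

section \<open>Multinomial vectors and independent draws\<close>

instance multiset :: (countable) countable
proof
  have "mset (SOME xs. mset xs = A) = A" for A :: "'a multiset"
    by (rule someI_ex) (rule ex_mset)
  then have "inj (\<lambda>A :: 'a multiset. SOME xs. mset xs = A)"
    by (intro inj_on_inverseI[where g = mset])
  then have "inj (to_nat \<circ> (\<lambda>A :: 'a multiset. SOME xs. mset xs = A))"
    by (rule inj_compose[OF inj_to_nat])
  then show "\<exists>to_nat :: 'a multiset \<Rightarrow> nat. inj to_nat" by blast
qed

lemma pmf_with_masses: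
  fixes p :: "nat \<Rightarrow> real"
  assumes "\<And>j. 0 \<le> p j" "p sums 1"
  obtains q where "pmf q = p"
proof
  have "(\<integral>\<^sup>+ j. ennreal (p j) \<partial>count_space UNIV) = 1"
    using assms sums_unique[OF assms(2)] by (subst nn_integral_count_space_nat)
      (simp add: suminf_ennreal_eq)
  then show "pmf (embed_pmf p) = p"
    using assms by (intro ext pmf_embed_pmf) auto
qed

lemma replicate_pmf_Suc_pair:
  "replicate_pmf (Suc n) q = map_pmf (\<lambda>(x, xs). x # xs) (pair_pmf q (replicate_pmf n q))"
  by (simp add: pair_pmf_def map_bind_pmf)

lemma pmf_replicate_pmf: "pmf (replicate_pmf (length xs) q) xs = (\<Prod>x\<leftarrow>xs. pmf q x)"
proof (induction xs)
  case (Cons x xs)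
  have "inj (\<lambda>(x, xs). x # (xs :: 'a list))" by (auto simp: inj_def)
  from pmf_map_inj'[OF this, of "pair_pmf q (replicate_pmf (length xs) q)" "(x, xs)"]
  show ?case
    by (simp only: list.size(4) add_0_right add_Suc_right One_nat_def replicate_pmf_Suc_pair
        case_prod_conv pmf_pair Cons.IH list.map prod_list.Cons)
qed simp

text \<open>
  All orderings of a sample are equally likely, and their number is the multinomial coefficient.
  This identifies the multinomial law with the law of the multiset of \<open>n\<close> independent draws.
\<close>
lemma pmf_mset_replicate_pmf:
  assumes "size A = n"
  shows "pmf (map_pmf mset (replicate_pmf n q)) A =
    fact n / (\<Prod>x\<in>set_mset A. fact (count A x)) * (\<Prod>x\<in>set_mset A. pmf q x ^ count A x)"
proof -
  have "pmf (map_pmf mset (replicate_pmf n q)) A =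
      measure (measure_pmf (replicate_pmf n q)) (permutations_of_multiset A)"
    by (simp add: pmf_map vimage_def permutations_of_multiset_def)
  also have "\<dots> = (\<Sum>xs\<in>permutations_of_multiset A. pmf (replicate_pmf n q) xs)"
    by (rule measure_measure_pmf_finite) simp
  also have "\<dots> = (\<Sum>xs\<in>permutations_of_multiset A. (\<Prod>x\<in>set_mset A. pmf q x ^ count A x))"
  proof (rule sum.cong[OF refl])
    fix xs assume "xs \<in> permutations_of_multiset A"
    then have xs: "mset xs = A" by (rule permutations_of_multisetD)
    then have "length xs = n" using assms by (metis size_mset)
    then have "pmf (replicate_pmf n q) xs = prod_mset (image_mset (pmf q) (mset xs))"
      using pmf_replicate_pmf[of xs q] by (simp flip: prod_mset_prod_list)
    then show "pmf (replicate_pmf n q) xs = (\<Prod>x\<in>set_mset A. pmf q x ^ count A x)"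
      by (simp add: image_prod_mset_multiplicity xs)
  qed
  also have "\<dots> = real (card (permutations_of_multiset A)) * (\<Prod>x\<in>set_mset A. pmf q x ^ count A x)"
    by simp
  also have "real (card (permutations_of_multiset A)) = fact n / (\<Prod>x\<in>set_mset A. fact (count A x))"
    unfolding card_permutations_of_multiset using assms
    by (subst real_of_nat_div[OF card_permutations_of_multiset(2)]) simp
  finally show ?thesis .
qed

text \<open>
  Each observation equals \<open>j\<close> with probability \<open>pmf q j\<close>, so the count is a sum of independent
  Bernoulli variables.
\<close>
lemma map_pmf_count_replicate_pmf:
  "map_pmf (\<lambda>xs. count (mset xs) j) (replicate_pmf n q) = binomial_pmf n (pmf q j)"
proof (induction n)
  case 0
  show ?case by (simp add: binomial_pmf_0 pmf_le_1)
next
  case (Suc n)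
  have b: "map_pmf (\<lambda>x. x = j) q = bernoulli_pmf (pmf q j)"
  proof (rule pmf_eqI)
    fix b
    have T: "pmf (map_pmf (\<lambda>x. x = j) q) True = pmf q j"
      by (simp add: pmf_map vimage_def measure_pmf_single)
    moreover have "pmf (map_pmf (\<lambda>x. x = j) q) False = 1 - pmf (map_pmf (\<lambda>x. x = j) q) True"
      by (rule pmf_False_conv_True)
    ultimately show "pmf (map_pmf (\<lambda>x. x = j) q) b = pmf (bernoulli_pmf (pmf q j)) b"
      by (cases b) (simp_all add: pmf_le_1)
  qed
  have "binomial_pmf (Suc n) (pmf q j) = bind_pmf (map_pmf (\<lambda>x. x = j) q)
      (\<lambda>b. bind_pmf (map_pmf (\<lambda>xs. count (mset xs) j) (replicate_pmf n q))
        (\<lambda>k. return_pmf ((if b then 1 else 0) + k)))"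
    unfolding b Suc.IH by (rule binomial_pmf_Suc) (simp add: pmf_le_1)
  also have "\<dots> = map_pmf (\<lambda>xs. count (mset xs) j) (replicate_pmf (Suc n) q)"
    by (auto simp: map_bind_pmf bind_map_pmf intro!: bind_pmf_cong)
  finally show ?case ..
qed

lemma count_replicate_pmf_expectation:
  fixes f :: "nat \<Rightarrow> real"
  shows "integrable (measure_pmf (replicate_pmf n q)) (\<lambda>xs. f (count (mset xs) j))"
    and "measure_pmf.expectation (replicate_pmf n q) (\<lambda>xs. f (count (mset xs) j)) =
      binom_mean n (pmf q j) f"
proof -
  have p: "pmf q j \<in> {0..1}" by (simp add: pmf_le_1)
  have "integrable (measure_pmf (map_pmf (\<lambda>xs. count (mset xs) j) (replicate_pmf n q))) f"
    unfolding map_pmf_count_replicate_pmf by (rule integrable_binomial_pmf[OF p])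
  then show "integrable (measure_pmf (replicate_pmf n q)) (\<lambda>xs. f (count (mset xs) j))"
    by simp
  have "measure_pmf.expectation (replicate_pmf n q) (\<lambda>xs. f (count (mset xs) j)) =
      measure_pmf.expectation (map_pmf (\<lambda>xs. count (mset xs) j) (replicate_pmf n q)) f"
    by simp
  also have "\<dots> = binom_mean n (pmf q j) f"
    unfolding map_pmf_count_replicate_pmf expectation_binomial_pmf'[OF p]
    by (simp add: binom_mean_def Bernstein_def)
  finally show "measure_pmf.expectation (replicate_pmf n q) (\<lambda>xs. f (count (mset xs) j)) =
      binom_mean n (pmf q j) f" .
qed

text \<open>
  No mass can be gained at one point, since both total masses are \<open>1\<close>.
\<close>
lemma prob_space_countable_eq_pmf:
  fixes N :: "'a :: countable measure"
  assumes "prob_space N" "sets N = UNIV" "\<And>x. pmf D x \<le> measure N {x}"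
  shows "N = measure_pmf D"
proof -
  interpret prob_space N by fact
  have null: "AE x in N. x = a \<longrightarrow> measure N {a} \<noteq> 0" for a
  proof (cases "measure N {a} = 0")
    case True
    then have "{a} \<in> null_sets N"
      using assms(2) by (auto simp: null_sets_def emeasure_eq_measure)
    then show ?thesis by (rule AE_I') auto
  qed simp
  have "AE x in N. \<forall>a. x = a \<longrightarrow> measure N {a} \<noteq> 0"
    unfolding AE_all_countable using null by blast
  then have "AE x in N. measure N {x} \<noteq> 0" by eventually_elim auto
  then have N: "measure_pmf (Abs_pmf N) = N"
    using assms by (intro Abs_pmf_inverse) auto
  have "\<not> pmf (Abs_pmf N) x < pmf D x" for x
    using assms(3)[of x] by (simp add: pmf.rep_eq N not_less)
  then have "Abs_pmf N = D" using pmf_neq_exists_less by blast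
  with N show ?thesis by simp
qed

text \<open>
  A multinomial vector is only specified through the probabilities of the count vectors. These
  add up to \<open>1\<close>, because they are the point masses of the multiset of \<open>n\<close> independent draws;
  hence the vector almost surely is such a count vector, and expectations may be computed
  in the model of independent draws.
\<close>
lemma integral_multinomial_vector:
  fixes X :: "nat \<Rightarrow> 'a \<Rightarrow> nat" and F :: "(nat \<Rightarrow> nat) \<Rightarrow> real"
  assumes X: "multinomial_vector M n (pmf q) X" and "n \<ge> 1"
    and F: "(\<lambda>\<omega>. F (\<lambda>j. X j \<omega>)) \<in> borel_measurable M"
  shows "(\<integral>\<omega>. F (\<lambda>j. X j \<omega>) \<partial>M) =
    measure_pmf.expectation (replicate_pmf n q) (\<lambda>xs. F (count (mset xs)))"
proof -
  define D where "D = map_pmf mset (replicate_pmf n q)"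
  interpret prob_space M using X by (simp add: multinomial_vector_def)
  have meas [measurable]: "X j \<in> measurable M (count_space UNIV)" for j
    using X by (simp add: multinomial_vector_def)
  define E where "E A = {\<omega> \<in> space M. \<forall>j. X j \<omega> = count A j}" for A
  have E [measurable]: "E A \<in> sets M" for A unfolding E_def by measurable
  have prob_E: "measure M (E A) = pmf D A" if "size A = n" for A
  proof -
    have "{j. count A j \<noteq> 0} = set_mset A" by (auto simp: count_eq_zero_iff)
    moreover have "(\<Sum>j\<in>set_mset A. count A j) = n"
      using that by (simp add: size_multiset_overloaded_eq)
    ultimately show ?thesis
      using X unfolding D_def pmf_mset_replicate_pmf[OF that]
      by (simp add: multinomial_vector_def E_def)
  qed
  \<comment> \<open>the multiset of observed values, with the junk value \<open>{#}\<close>, whose size is not \<open>n\<close>\<close>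
  define Y where "Y \<omega> = (if \<exists>A. size A = n \<and> \<omega> \<in> E A then THE A. size A = n \<and> \<omega> \<in> E A else {#})" for \<omega>
  have E_disj: "A = B" if "\<omega> \<in> E A" "\<omega> \<in> E B" for \<omega> A B
    using that by (auto simp: E_def multiset_eq_iff)
  have Y_eq: "Y \<omega> = A" if "size A = n" "\<omega> \<in> E A" for \<omega> A
  proof -
    have "(THE A. size A = n \<and> \<omega> \<in> E A) = A"
      using that E_disj by (intro the_equality) auto
    then show ?thesis using that by (auto simp: Y_def)
  qed
  have Y_E: "\<omega> \<in> E (Y \<omega>)" if "Y \<omega> \<noteq> {#}" for \<omega>
  proof -
    from that obtain A where "size A = n" "\<omega> \<in> E A" by (auto simp: Y_def split: if_splits)
    with Y_eq show ?thesis by metis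
  qed
  have preimage: "Y -` {A} \<inter> space M =
      (if size A = n then E A else if A = {#} then space M - (\<Union>A\<in>{A. size A = n}. E A) else {})" for A
  proof -
    have 1: "E A \<subseteq> space M" by (auto simp: E_def)
    have 2: "\<omega> \<in> E A \<and> size A = n" if "Y \<omega> = A" "A \<noteq> {#}" for \<omega>
    proof -
      from that obtain B where "size B = n" "\<omega> \<in> E B" by (auto simp: Y_def split: if_splits)
      with Y_eq that show ?thesis by metis
    qed
    have 3: "(\<forall>A. size A = n \<longrightarrow> \<omega> \<notin> E A)" if "Y \<omega> = {#}" for \<omega>
    proof (intro allI impI notI)
      fix A assume "size A = n" "\<omega> \<in> E A"
      with Y_eq that have "A = {#}" by metis
      with \<open>size A = n\<close> assms(2) show False by simp
    qed
    have 4: "Y \<omega> = {#}" if "(\<forall>A. size A = n \<longrightarrow> \<omega> \<notin> E A)" for \<omega>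
      using that by (auto simp: Y_def)
    consider "size A = n" | "size A \<noteq> n" "A = {#}" | "size A \<noteq> n" "A \<noteq> {#}" by blast
    then show ?thesis
    proof cases
      case 1
      then have "A \<noteq> {#}" using assms(2) by auto
      then have "Y \<omega> = A \<longleftrightarrow> \<omega> \<in> E A" for \<omega> using 1 Y_eq 2 by metis
      then show ?thesis using 1 \<open>E A \<subseteq> space M\<close> by auto
    next
      case 2
      have "Y \<omega> = {#} \<longleftrightarrow> (\<forall>A. size A = n \<longrightarrow> \<omega> \<notin> E A)" for \<omega> using 3 4 by metis
      then show ?thesis using 2 by auto
    next
      case 3
      then have "Y \<omega> \<noteq> A" for \<omega> using 2 by metis
      then show ?thesis using 3 by auto
    qed
  qed
  have Y_meas [measurable]: "Y \<in> measurable M (count_space UNIV)"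
  proof -
    have "(\<Union>A\<in>{A. size A = n}. E A) \<in> sets M"
      by (rule sets.countable_UN') auto
    then show ?thesis
      unfolding measurable_count_space_eq2_countable preimage by auto
  qed
  have "distr M (count_space UNIV) Y = measure_pmf D"
  proof (rule prob_space_countable_eq_pmf)
    show "prob_space (distr M (count_space UNIV) Y)" by (rule prob_space_distr[OF Y_meas])
    fix A
    show "pmf D A \<le> measure (distr M (count_space UNIV) Y) {A}"
    proof (cases "size A = n")
      case True
      then show ?thesis by (simp add: measure_distr preimage prob_E)
    next
      case False
      then have "A \<notin> set_pmf D" by (auto simp: D_def set_replicate_pmf)
      then show ?thesis by (simp add: set_pmf_eq)
    qed
  qed simp
  then have D: "measure_pmf D = distr M (count_space UNIV) Y" ..
  have "AE A in D. A \<noteq> {#}"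
    using assms(2) by (auto simp: AE_measure_pmf_iff D_def set_replicate_pmf)
  then have "AE \<omega> in M. Y \<omega> \<noteq> {#}"
    unfolding D by (rule AE_distrD[OF Y_meas])
  then have ae: "AE \<omega> in M. F (\<lambda>j. X j \<omega>) = F (count (Y \<omega>))"
  proof eventually_elim
    case (elim \<omega>)
    then have "(\<lambda>j. X j \<omega>) = count (Y \<omega>)" using Y_E[of \<omega>] by (auto simp: E_def)
    then show ?case by simp
  qed
  have "(\<integral>\<omega>. F (\<lambda>j. X j \<omega>) \<partial>M) = (\<integral>\<omega>. F (count (Y \<omega>)) \<partial>M)"
    by (rule integral_cong_AE[OF F _ ae]) measurable
  also have "\<dots> = measure_pmf.expectation D (\<lambda>A. F (count A))"
    unfolding D by (subst integral_distr) auto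
  finally show ?thesis by (simp add: D_def)
qed

lemma xlnx_of_nat_nonneg: "0 \<le> xlnx (real k)"
  by (cases "k = 0") (auto simp: xlnx_def)

text \<open>
  The summands of the plug-in entropy are nonnegative with means at most \<open>p j * ln n\<close>, which are
  summable; so the expectation can be taken term by term. The entropy and
  the bias terms appear in one series, since the entropy series is not known to converge at this
  point.
\<close>
lemma expected_plugin_entropy_sums:
  fixes X :: "nat \<Rightarrow> 'a \<Rightarrow> nat"
  assumes X: "multinomial_vector M n p X" and n: "n \<ge> 1"
    and p: "\<And>j. p j > 0" "p sums 1"
  shows "(\<lambda>j. - (p j * ln (p j)) - bias_fun n (real n * p j) / real n) sums
    (\<integral>\<omega>. plugin_entropy n (\<lambda>j. X j \<omega>) \<partial>M)"
proof -
  obtain q where q: "pmf q = p" using pmf_with_masses[of p] p less_imp_le by metis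
  have [measurable]: "X j \<in> measurable M (count_space UNIV)" for j
    using X by (simp add: multinomial_vector_def)
  have "(\<lambda>\<omega>. plugin_entropy n (\<lambda>j. X j \<omega>)) \<in> borel_measurable M"
    unfolding plugin_entropy_def by measurable
  then have E1: "(\<integral>\<omega>. plugin_entropy n (\<lambda>j. X j \<omega>) \<partial>M) =
      measure_pmf.expectation (replicate_pmf n q) (\<lambda>xs. plugin_entropy n (count (mset xs)))"
    using X n by (intro integral_multinomial_vector) (simp_all add: q)
  define u :: "nat \<Rightarrow> real"
    where "u k = real k / real n * ln (real n) - xlnx (real k) / real n" for k
  have u_eq: "u k = - (real k / real n * ln (real k / real n))" for k
    using n by (cases "k = 0") (auto simp: u_def xlnx_def ln_div field_simps)
  have u_nonneg: "0 \<le> u k" if "k \<le> n" for k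
  proof (cases "k = 0")
    case False
    then have "ln (real k / real n) \<le> 0" using that n by (subst ln_le_zero_iff) auto
    then have "real k / real n * ln (real k / real n) \<le> 0"
      by (intro mult_nonneg_nonpos) auto
    then show ?thesis unfolding u_eq by simp
  qed (simp add: u_eq)
  have AE_u: "AE xs in replicate_pmf n q. norm (u (count (mset xs) j)) = u (count (mset xs) j)" for j
    unfolding AE_measure_pmf_iff set_replicate_pmf
    using u_nonneg count_le_size[of "mset _" j] by auto
  have E_u: "measure_pmf.expectation (replicate_pmf n q) (\<lambda>xs. u (count (mset xs) j)) =
      p j * ln (real n) - binom_mean n (p j) (\<lambda>k. xlnx (real k)) / real n" for j
  proof -
    have "binom_mean n (p j) u = binom_mean n (p j)
        (\<lambda>k. (ln (real n) / real n) * real k - (1 / real n) * xlnx (real k))"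
      by (simp add: u_def[abs_def] mult_ac)
    also have "\<dots> = p j * ln (real n) - binom_mean n (p j) (\<lambda>k. xlnx (real k)) / real n"
      unfolding binom_mean_diff binom_mean_cmult binom_mean_of_nat using n by simp
    finally show ?thesis by (simp add: count_replicate_pmf_expectation q)
  qed
  have "(\<lambda>j. measure_pmf.expectation (replicate_pmf n q) (\<lambda>xs. u (count (mset xs) j))) sums
      measure_pmf.expectation (replicate_pmf n q) (\<lambda>xs. \<Sum>j. u (count (mset xs) j))"
  proof (rule sums_integral)
    show "integrable (replicate_pmf n q) (\<lambda>xs. u (count (mset xs) j))" for j
      by (rule count_replicate_pmf_expectation)
    have "summable (\<lambda>j. norm (u (count A j)))" for A
      by (rule summable_finite[of "set_mset A"]) (auto simp: u_def xlnx_def count_eq_zero_iff)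
    then show "AE xs in replicate_pmf n q. summable (\<lambda>j. norm (u (count (mset xs) j)))" by simp
    have "(\<integral>xs. norm (u (count (mset xs) j)) \<partial>replicate_pmf n q) =
        (\<integral>xs. u (count (mset xs) j) \<partial>replicate_pmf n q)" for j
      by (rule integral_cong_AE[OF _ _ AE_u]) auto
    moreover have "norm (\<integral>xs. u (count (mset xs) j) \<partial>replicate_pmf n q) \<le> p j * ln (real n)" for j
    proof -
      have "binom_mean n (p j) (\<lambda>k. 0) \<le> binom_mean n (p j) (\<lambda>k. xlnx (real k))"
        using pmf_le_1[of q j] p(1)[of j] unfolding q by (intro binom_mean_mono) (auto simp: xlnx_of_nat_nonneg)
      then have "(\<integral>xs. u (count (mset xs) j) \<partial>replicate_pmf n q) \<le> p j * ln (real n)"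
        unfolding E_u using n by simp
      moreover have "0 \<le> (\<integral>xs. u (count (mset xs) j) \<partial>replicate_pmf n q)"
        using AE_u[of j] by (intro integral_nonneg_AE) (auto elim: eventually_mono)
      ultimately show ?thesis by simp
    qed
    ultimately show "summable (\<lambda>j. \<integral>xs. norm (u (count (mset xs) j)) \<partial>replicate_pmf n q)"
      using sums_summable[OF sums_mult2[OF p(2), of "ln (real n)"]]
      by (auto intro: summable_comparison_test')
  qed
  moreover have "plugin_entropy n (count A) = (\<Sum>j. u (count A j))" for A
  proof -
    have "summable (\<lambda>j. real (count A j) / real n * ln (real (count A j) / real n))"
      by (rule summable_finite[of "set_mset A"]) (auto simp: count_eq_zero_iff)
    then show ?thesis unfolding plugin_entropy_def u_eq by (rule suminf_minus[symmetric])
  qed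
  moreover have "p j * ln (real n) - binom_mean n (p j) (\<lambda>k. xlnx (real k)) / real n =
      - (p j * ln (p j)) - bias_fun n (real n * p j) / real n" for j
    using n p(1)[of j] by (simp add: bias_fun_def xlnx_def ln_mult field_simps)
  ultimately show ?thesis by (simp only: E_u E1)
qed

section \<open>The bias as an integral against the counting function\<close>

text \<open>
  A single power of \<open>y\<close> that dominates the logarithmic singularity at \<open>0\<close>; the
  constant grows as the exponent \<open>-\<delta>\<close> approaches \<open>0\<close>.
\<close>
lemma bias_deriv_le_powr:
  assumes "n \<ge> 1" "0 < y" "y \<le> real n" "0 < \<delta>" "\<delta> \<le> 1"
  shows "\<bar>bias_deriv n y\<bar> \<le> (2 + 1 / \<delta>) * y powr (- \<delta>)"
proof (cases "y \<le> 1")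
  case True
  have "ln (y powr (- \<delta>)) \<le> y powr (- \<delta>) - 1"
    by (rule ln_le_minus_one) (use assms in auto)
  then have "\<delta> * \<bar>ln y\<bar> \<le> y powr (- \<delta>)"
    using assms True by (simp add: ln_powr abs_if)
  then have "\<bar>ln y\<bar> \<le> 1 / \<delta> * y powr (- \<delta>)"
    using assms by (simp add: field_simps)
  moreover have "1 \<le> y powr (- \<delta>)"
    using powr_mono2'[of "- \<delta>" y 1] assms True by simp
  moreover have "\<bar>bias_deriv n y\<bar> \<le> 1 + y + \<bar>ln y\<bar>"
    by (rule bias_deriv_bounds) (use assms in auto)
  ultimately show ?thesis using True unfolding distrib_right by linarith
next
  case False
  have "\<bar>bias_deriv n y\<bar> \<le> 1 / y" by (rule bias_deriv_bounds) (use assms in auto)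
  also have "1 / y = y powr (- 1)" using assms by (simp add: powr_minus_divide)
  also have "\<dots> \<le> y powr (- \<delta>)" by (rule powr_mono) (use assms False in auto)
  also have "\<dots> \<le> (2 + 1 / \<delta>) * y powr (- \<delta>)" using assms by simp
  finally show ?thesis .
qed

lemma bias_deriv_measurable [measurable]: "bias_deriv n \<in> borel_measurable borel"
  unfolding bias_deriv_def[abs_def] binom_mean_def Bernstein_def
  by (intro borel_measurable_diff borel_measurable_sum borel_measurable_times borel_measurable_power borel_measurable_divide
     borel_measurable_ln borel_measurable_const measurable_ident_sets refl measurable_ident)

lemma continuous_on_xlnx: "continuous_on {0..} xlnx"
  unfolding continuous_on_def
proof
  fix t :: real assume "t \<in> {0..}"
  then consider "t = 0" | "t > 0" by fastforce
  then show "(xlnx \<longlongrightarrow> xlnx t) (at t within {0..})"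
  proof cases
    case 1
    have "((\<lambda>t :: real. t * ln t) \<longlongrightarrow> 0) (at_right 0)" by real_asymp
    then show ?thesis
      unfolding 1 xlnx_def at_within_Ici_at_right by simp
  next
    case 2
    have "(xlnx has_real_derivative ln t + 1) (at t)"
      unfolding xlnx_def[abs_def] using 2 by (auto intro!: derivative_eq_intros)
    then have "isCont xlnx t" by (rule DERIV_isCont)
    then have "(xlnx \<longlongrightarrow> xlnx t) (at t)" by (simp only: isCont_def)
    then show ?thesis by (rule tendsto_within_subset) simp
  qed
qed

text \<open>
  The derivative is unbounded at \<open>0\<close>, but absolutely integrable there, and \<open>bias_fun n 0 = 0\<close>.
\<close>
lemma bias_fun_eq_integral:
  assumes "n \<ge> 1" "0 \<le> b" "b \<le> real n"
  shows "integrable lborel (\<lambda>y. indicator {0<..b} y * bias_deriv n y)" (is ?int)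
    and "(\<integral>y. indicator {0<..b} y * bias_deriv n y \<partial>lborel) = bias_fun n b"
proof -
  show int: ?int
  proof (rule Bochner_Integration.integrable_bound)
    show "integrable lborel (\<lambda>y. 4 * (indicator {0<..b} y * y powr (- 1 / 2)))"
      by (intro integrable_mult_right integrable_lborel_nonneg)
        (use integrable_on_powr_from_0'[of "- 1 / 2" b] assms(2) in auto)
    have "\<bar>bias_deriv n y\<bar> \<le> 4 * y powr (- 1 / 2)" if "0 < y" "y \<le> b" for y
      using bias_deriv_le_powr[of n y "1 / 2"] assms that by simp
    then show "AE y in lborel. norm (indicator {0<..b} y * bias_deriv n y)
        \<le> norm (4 * (indicator {0<..b} y * y powr (- 1 / 2)))"
      by (intro AE_I2) (auto simp: indicator_def)
  qed measurable
  have cont: "continuous_on {0..b} (bias_fun n)"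
    unfolding bias_fun_def[abs_def] binom_mean_def Bernstein_def
    by (intro continuous_intros continuous_on_subset[OF continuous_on_xlnx]) (use assms in auto)
  have "(bias_deriv n has_integral (bias_fun n b - bias_fun n 0)) {0..b}"
  proof (rule fundamental_theorem_of_calculus_interior[OF assms(2) cont])
    fix y assume "y \<in> {0<..<b}"
    then show "(bias_fun n has_vector_derivative bias_deriv n y) (at y)"
      using bias_fun_has_derivative[OF assms(1), of y]
      by (simp add: has_real_derivative_iff_has_vector_derivative)
  qed
  moreover have "bias_fun n 0 = 0" by (simp add: bias_fun_def xlnx_def)
  ultimately have "(bias_deriv n has_integral bias_fun n b) {0..b}" by simp
  moreover have "(bias_deriv n has_integral bias_fun n b) {0..b} \<longleftrightarrow>
      (bias_deriv n has_integral bias_fun n b) {0<..b}"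
  proof (rule has_integral_spike_set_eq)
    have "{y \<in> {0..b} - {0<..b}. bias_deriv n y \<noteq> 0} \<subseteq> {0}" by auto
    then show "negligible {y \<in> {0..b} - {0<..b}. bias_deriv n y \<noteq> 0}"
      by (rule negligible_subset[OF negligible_sing])
    have "{y \<in> {0<..b} - {0..b}. bias_deriv n y \<noteq> 0} = {}" by auto
    then show "negligible {y \<in> {0<..b} - {0..b}. bias_deriv n y \<noteq> 0}"
      by (simp only: negligible_empty)
  qed
  ultimately have "(bias_deriv n has_integral bias_fun n b) {0<..b}" by blast
  moreover have "(bias_deriv n has_integral (LINT y:{0<..b}|lborel. bias_deriv n y)) {0<..b}"
  proof -
    have "set_integrable lborel {0<..b} (bias_deriv n)"
      using int by (simp only: set_integrable_def real_scaleR_def)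
    from set_borel_integral_eq_integral[OF this] show ?thesis
      by (simp only: has_integral_integrable_integral)
  qed
  ultimately have "(LINT y:{0<..b}|lborel. bias_deriv n y) = bias_fun n b"
    using has_integral_unique by blast
  then show "(\<integral>y. indicator {0<..b} y * bias_deriv n y \<partial>lborel) = bias_fun n b"
    by (simp add: set_lebesgue_integral_def)
qed

text \<open>
  By size biasing, \<open>bias_fun n y = y * (E ln (B + 1) - ln y)\<close> with \<open>B\<close> binomial for \<open>n - 1\<close> trials.
  Both bounds are then lower bounds for \<open>E ln (B + 1)\<close>: by \<open>ln y\<close> and by \<open>0\<close>.
\<close>
lemma bias_fun_bounds:
  assumes "n \<ge> 1" "0 < y" "y \<le> real n"
  shows bias_fun_nonneg: "0 \<le> bias_fun n y"
    and bias_fun_ge: "- (y * ln y) \<le> bias_fun n y"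
proof -
  let ?A = "binom_mean (n - 1) (y / real n) (\<lambda>k. ln (real (Suc k)))"
  have "ln y \<le> ?A" by (rule binom_mean_ln_ge) (use assms in auto)
  then show "0 \<le> bias_fun n y" using assms by (simp add: bias_fun_eq)
  have "binom_mean (n - 1) (y / real n) (\<lambda>k. 0) \<le> ?A"
    by (rule binom_mean_mono) (use assms in auto)
  then have "y * (- ln y) \<le> y * (?A - ln y)" using assms by (intro mult_left_mono) auto
  then show "- (y * ln y) \<le> bias_fun n y" using assms by (simp add: bias_fun_eq)
qed

locale prob_vector =
  fixes p :: "nat \<Rightarrow> real"
  assumes p_pos: "p j > 0" and p_sums: "p sums 1"
begin

lemma p_le_1: "p j \<le> 1"
proof -
  have "(\<Sum>i\<in>{j}. p i) \<le> suminf p"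
    by (rule sum_le_suminf[OF sums_summable[OF p_sums]]) (auto intro: less_imp_le p_pos)
  then show ?thesis by (simp add: sums_unique[OF p_sums, symmetric])
qed

lemma finite_ge: "x > 0 \<Longrightarrow> finite {j. p j \<ge> x}"
proof -
  assume "x > 0"
  have "\<forall>\<^sub>F j in sequentially. p j < x"
    using summable_LIMSEQ_zero[OF sums_summable[OF p_sums]] \<open>x > 0\<close> by (rule order_tendstoD)
  then obtain J where "\<And>j. j \<ge> J \<Longrightarrow> p j < x" unfolding eventually_sequentially by blast
  then have J: "\<not> p j \<ge> x" if "j \<ge> J" for j using that by (simp add: not_le)
  have "{j. p j \<ge> x} \<subseteq> {..<J}"
  proof
    fix j assume "j \<in> {j. p j \<ge> x}"
    then have "\<not> j \<ge> J" using J[of j] by auto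
    then show "j \<in> {..<J}" by simp
  qed
  then show ?thesis by (rule finite_subset) simp
qed

lemma tail_count_mono: "0 < x \<Longrightarrow> x \<le> y \<Longrightarrow> tail_count p y \<le> tail_count p x"
proof -
  assume "0 < x" "x \<le> y"
  then have "{j. p j \<ge> y} \<subseteq> {j. p j \<ge> x}" by auto
  then show ?thesis unfolding tail_count_def by (rule card_mono[OF finite_ge[OF \<open>0 < x\<close>]])
qed

lemma tail_count_eq_0: "x > 1 \<Longrightarrow> tail_count p x = 0"
proof -
  assume "x > 1"
  then have "\<not> x \<le> p j" for j using p_le_1[of j] by simp
  then have "{j. p j \<ge> x} = {}" by simp
  then show ?thesis by (simp add: tail_count_def)
qed

lemma indicator_sums_tail_count:
  assumes "n \<ge> 1" "y > 0"
  shows "(\<lambda>j. indicator {0<..real n * p j} y) sums real (tail_count p (y / real n))"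
proof -
  have eq: "indicator {0<..real n * p j} y = (if j \<in> {j. p j \<ge> y / real n} then 1 else 0 :: real)" for j
    using assms by (auto simp: indicator_def field_simps)
  have "finite {j. p j \<ge> y / real n}"
    by (rule finite_ge) (use assms in auto)
  from sums_If_finite_set[OF this, of "\<lambda>_. 1 :: real"]
  have "(\<lambda>j. indicator {0<..real n * p j} y) sums (\<Sum>j | p j \<ge> y / real n. (1 :: real))"
    unfolding eq .
  then show ?thesis by (simp add: tail_count_def)
qed

lemma measurable_tail_count:
  assumes "n \<ge> 1"
  shows "(\<lambda>y. indicator {0<..} y * real (tail_count p (y / real n))) \<in> borel_measurable borel"
proof -
  have "indicator {0<..} y * real (tail_count p (y / real n)) =
      (\<Sum>j. indicator {0<..real n * p j} y :: real)" for y :: real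
    using sums_unique[OF indicator_sums_tail_count[OF assms, of y], symmetric] by (cases "y > 0") auto
  then show ?thesis by simp
qed

text \<open>
  Each summand is the integral of the derivative over \<open>(0, n p\<^sub>j]\<close>, and a point \<open>y\<close> lies in exactly
  \<open>tail_count p (y / n)\<close> of these intervals.
\<close>
lemma bias_fun_sums_integral:
  assumes n: "n \<ge> 1"
    and int: "integrable lborel
      (\<lambda>y. indicator {0<..} y * (bias_deriv n y * real (tail_count p (y / real n))))"
  shows "(\<lambda>j. bias_fun n (real n * p j)) sums
    (\<integral>y. indicator {0<..} y * (bias_deriv n y * real (tail_count p (y / real n))) \<partial>lborel)"
proof -
  define f where "f j y = indicator {0<..} y * (bias_deriv n y * indicator {0<..real n * p j} y)" for j y
  define g where "g y = indicator {0<..} y * (bias_deriv n y * real (tail_count p (y / real n)))" for y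
  have np: "0 \<le> real n * p j" "real n * p j \<le> real n" for j
    using p_pos[of j] p_le_1[of j] n by auto
  have f_eq: "f j = (\<lambda>y. indicator {0<..real n * p j} y * bias_deriv n y)" for j
    by (auto simp: f_def indicator_def fun_eq_iff)
  have f_int: "integrable lborel (f j)" "integral\<^sup>L lborel (f j) = bias_fun n (real n * p j)" for j
    unfolding f_eq using bias_fun_eq_integral[OF n np] by auto
  have g_int: "integrable lborel g" unfolding g_def[abs_def] by (rule int)
  have sums: "(\<lambda>j. indicator {0<..} y * (c * indicator {0<..real n * p j} y)) sums
      (indicator {0<..} y * (c * real (tail_count p (y / real n))))" for c y :: real
  proof (cases "y > 0")
    case True
    then show ?thesis by (intro sums_mult indicator_sums_tail_count[OF n])
  next
    case False
    then show ?thesis by simp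
  qed
  have f_sums: "(\<lambda>j. f j y) sums g y" for y
    unfolding f_def g_def by (rule sums)
  have f_norm_sums: "(\<lambda>j. norm (f j y)) sums norm (g y)" for y
  proof -
    have "norm (f j y) = indicator {0<..} y * (\<bar>bias_deriv n y\<bar> * indicator {0<..real n * p j} y)" for j
      by (simp add: f_def abs_mult)
    moreover have "norm (g y) = indicator {0<..} y * (\<bar>bias_deriv n y\<bar> * real (tail_count p (y / real n)))"
      by (simp add: g_def abs_mult)
    ultimately show ?thesis using sums by (simp only:)
  qed
  have "(\<lambda>j. integral\<^sup>L lborel (f j)) sums (\<integral>y. (\<Sum>j. f j y) \<partial>lborel)"
  proof (rule sums_integral)
    show "integrable lborel (f j)" for j by (rule f_int)
    show "AE y in lborel. summable (\<lambda>j. norm (f j y))"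
      using sums_summable[OF f_norm_sums] by simp
    show "summable (\<lambda>j. \<integral>y. norm (f j y) \<partial>lborel)"
    proof (rule summableI_nonneg_bounded)
      fix J
      have "(\<Sum>j<J. \<integral>y. norm (f j y) \<partial>lborel) = (\<integral>y. (\<Sum>j<J. norm (f j y)) \<partial>lborel)"
        using f_int(1) by (subst Bochner_Integration.integral_sum) auto
      also have "\<dots> \<le> (\<integral>y. norm (g y) \<partial>lborel)"
      proof (rule integral_mono)
        show "(\<Sum>j<J. norm (f j y)) \<le> norm (g y)" for y
          using sum_le_suminf[OF sums_summable[OF f_norm_sums], of "{..<J}" y]
          unfolding sums_unique[OF f_norm_sums, symmetric] by simp
      qed (use f_int(1) g_int in auto)
      finally show "(\<Sum>j<J. \<integral>y. norm (f j y) \<partial>lborel) \<le> (\<integral>y. norm (g y) \<partial>lborel)" .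
    qed simp
  qed
  then show ?thesis
    unfolding f_int(2) sums_unique[OF f_sums, symmetric] unfolding g_def .
qed

end

section \<open>Regularly varying tails\<close>

locale regular_tail = prob_vector p for p :: "nat \<Rightarrow> real" +
  fixes \<alpha> :: real and L :: "real \<Rightarrow> real"
  assumes alpha: "0 < \<alpha>" "\<alpha> < 1"
    and slow: "slowly_varying L"
    and tail: "x \<in> {0<..1} \<Longrightarrow> real (tail_count p x) = x powr (- \<alpha>) * L (1 / x)"
begin

text \<open>
  The counting function of the masses, turned into a nondecreasing function on \<open>(0, \<infinity>)\<close> that is
  regularly varying of index \<open>\<alpha>\<close> at infinity.
\<close>
definition U :: "real \<Rightarrow> real"
  where "U t = real (tail_count p (1 / t))"

lemma U_mono: "0 < s \<Longrightarrow> s \<le> t \<Longrightarrow> U s \<le> U t"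
  unfolding U_def of_nat_le_iff by (rule tail_count_mono) (auto simp: frac_le)

lemma U_nonneg: "0 \<le> U t" by (simp add: U_def)

lemma U_eq: "t \<ge> 1 \<Longrightarrow> U t = t powr \<alpha> * L t"
  using tail[of "1 / t"] by (simp add: U_def powr_divide powr_minus)

lemma eventually_L_pos: "\<forall>\<^sub>F t in at_top. L t > 0"
  using slow by (simp add: slowly_varying_def)

lemma eventually_U_pos: "\<forall>\<^sub>F t in at_top. U t > 0"
  using eventually_L_pos eventually_ge_at_top[of 1] by eventually_elim (simp add: U_eq)

lemma eventually_U_nat_pos: "\<forall>\<^sub>F n in sequentially. U (real n) > 0"
  using filterlim_iff[THEN iffD1, OF filterlim_real_sequentially] eventually_U_pos by blast

lemma U_ratio:
  assumes "c > 0"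
  shows "((\<lambda>t. U (c * t) / U t) \<longlongrightarrow> c powr \<alpha>) at_top"
proof -
  have "((\<lambda>t. L (c * t) / L t) \<longlongrightarrow> 1) at_top"
    using slow assms by (simp add: slowly_varying_def)
  then have "((\<lambda>t. c powr \<alpha> * (L (c * t) / L t)) \<longlongrightarrow> c powr \<alpha> * 1) at_top"
    by (intro tendsto_intros)
  moreover have "\<forall>\<^sub>F t in at_top. c powr \<alpha> * (L (c * t) / L t) = U (c * t) / U t"
    using eventually_ge_at_top[of 1] eventually_ge_at_top[of "1 / c"]
  proof eventually_elim
    case (elim t)
    then have "1 \<le> c * t" using assms by (simp add: field_simps)
    then show ?case using elim assms by (simp add: U_eq powr_mult)
  qed
  ultimately show ?thesis by (simp add: tendsto_cong)
qed

lemma U_ratio_nat: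
  assumes "c > 0"
  shows "(\<lambda>n. U (c * real n) / U (real n)) \<longlonglongrightarrow> c powr \<alpha>"
  using filterlim_compose[OF U_ratio[OF assms] filterlim_real_sequentially] .

text \<open>
  The integrand representing \<open>n\<close> times the bias, normalised by \<open>U n\<close>.
\<close>
definition scaled :: "nat \<Rightarrow> real \<Rightarrow> real"
  where "scaled n y = indicator {0<..} y * (bias_deriv n y * (real (tail_count p (y / real n)) / U (real n)))"

lemma scaled_measurable: "n \<ge> 1 \<Longrightarrow> scaled n \<in> borel_measurable borel"
proof -
  assume "n \<ge> 1"
  have "scaled n = (\<lambda>y. bias_deriv n y *
      ((indicator {0<..} y * real (tail_count p (y / real n))) / U (real n)))"
    by (auto simp: scaled_def)
  moreover have "\<dots> \<in> borel_measurable borel"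
    by (intro borel_measurable_times bias_deriv_measurable borel_measurable_divide
        measurable_tail_count[OF \<open>n \<ge> 1\<close>] borel_measurable_const)
  ultimately show ?thesis by simp
qed

lemma scaled_tendsto: "(\<lambda>n. scaled n y) \<longlonglongrightarrow> indicator {0<..} y * (y powr (- \<alpha>) * psi y)"
proof (cases "y > 0")
  case True
  have "(\<lambda>n. U (1 / y * real n) / U (real n)) \<longlonglongrightarrow> (1 / y) powr \<alpha>"
    using True by (intro U_ratio_nat) simp
  also have "(1 / y) powr \<alpha> = y powr (- \<alpha>)" using True by (simp add: powr_divide powr_minus_divide)
  finally have "(\<lambda>n. bias_deriv n y * (U (1 / y * real n) / U (real n))) \<longlonglongrightarrow> psi y * y powr (- \<alpha>)"
    by (intro tendsto_mult bias_deriv_tendsto_psi True)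
  then show ?thesis
    using True by (simp add: scaled_def U_def mult.commute)
qed (simp add: scaled_def)

text \<open>
  Near \<open>0\<close> the bounds combine to the exponent \<open>-\<alpha> - 2 \<delta> > -1\<close>, and towards infinity to
  \<open>\<delta> - \<alpha> - 1 < -1\<close>; beyond \<open>n\<close> the integrand vanishes since no mass exceeds \<open>1\<close>.
\<close>
lemma scaled_dominated:
  obtains N0 :: nat and W where "N0 \<ge> 1" "integrable lborel W"
    "\<And>n y. n \<ge> N0 \<Longrightarrow> \<bar>scaled n y\<bar> \<le> W y"
proof -
  \<comment> \<open>small enough for both resulting exponents of \<open>y\<close> to be integrable\<close>
  define \<delta> where "\<delta> = min (\<alpha> / 2) ((1 - \<alpha>) / 3)"
  have \<delta>: "0 < \<delta>" "\<delta> < \<alpha>" "\<alpha> + 2 * \<delta> < 1" "\<delta> \<le> 1"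
    using alpha by (auto simp: \<delta>_def min_def field_simps)
  obtain T K where TK: "T \<ge> 1" "K > 0"
    "\<And>t y. t \<ge> T \<Longrightarrow> 0 < y \<Longrightarrow> y \<le> 1 \<Longrightarrow> U (t / y) \<le> K * y powr (- \<alpha> - \<delta>) * U t"
    "\<And>t y. t \<ge> T \<Longrightarrow> 1 \<le> y \<Longrightarrow> y \<le> t \<Longrightarrow> U (t / y) \<le> K * y powr (\<delta> - \<alpha>) * U t"
    using potter_bounds[where U = U and \<alpha> = \<alpha> and \<delta> = \<delta>, OF U_mono U_nonneg eventually_U_pos U_ratio \<delta>(1,2)]
    by (metis zero_less_numeral)
  obtain T' where T': "\<And>t. t \<ge> T' \<Longrightarrow> U t > 0"
    using eventually_U_pos unfolding eventually_at_top_linorder by blast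
  define N0 where "N0 = nat \<lceil>max T T'\<rceil>"
  define W where "W y = ((2 + 1 / \<delta>) * K) * (indicator {0<..1} y * y powr (- \<alpha> - 2 * \<delta>)) +
    K * (indicator {1..} y * y powr (\<delta> - \<alpha> - 1))" for y
  have N0: "real n \<ge> T" "real n \<ge> T'" if "n \<ge> N0" for n
    using that by (auto simp: N0_def) 
  show thesis
  proof
    show "N0 \<ge> 1" using N0(1)[of N0] TK(1) by (cases N0) auto
    show "integrable lborel W"
      unfolding W_def[abs_def] using \<delta> alpha
      by (intro Bochner_Integration.integrable_add integrable_mult_right
          integrable_powr_near_0 integrable_powr_near_infinity) auto
    fix n y assume n: "n \<ge> N0"
    have Upos: "U (real n) > 0" using T' N0(2)[OF n] by blast
    have n1: "n \<ge> 1" using N0(1)[OF n] TK(1) by (cases n) auto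
    have W_nonneg: "0 \<le> W y" using TK(2) \<delta> by (simp add: W_def)
    have tail_U: "real (tail_count p (y / real n)) = U (real n / y)" by (simp add: U_def)
    consider "y \<le> 0" | "0 < y" "y \<le> 1" | "1 < y" "y \<le> real n" | "y > real n" "y > 0"
      by linarith
    then show "\<bar>scaled n y\<bar> \<le> W y"
    proof cases
      case 1
      then show ?thesis using W_nonneg by (simp add: scaled_def)
    next
      case 2
      have "U (real n / y) / U (real n) \<le> K * y powr (- \<alpha> - \<delta>)"
        using TK(3)[OF N0(1)[OF n] 2] Upos by (simp add: field_simps)
      moreover have "\<bar>bias_deriv n y\<bar> \<le> (2 + 1 / \<delta>) * y powr (- \<delta>)"
        by (rule bias_deriv_le_powr) (use n1 2 \<delta> in auto)
      ultimately have "\<bar>bias_deriv n y\<bar> * (U (real n / y) / U (real n)) \<le>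
          ((2 + 1 / \<delta>) * y powr (- \<delta>)) * (K * y powr (- \<alpha> - \<delta>))"
        by (intro mult_mono) (use U_nonneg \<delta> in auto)
      also have "\<dots> = ((2 + 1 / \<delta>) * K) * (y powr (- \<delta>) * y powr (- \<alpha> - \<delta>))"
        by (simp only: mult_ac)
      also have "y powr (- \<delta>) * y powr (- \<alpha> - \<delta>) = y powr (- \<alpha> - 2 * \<delta>)"
        unfolding powr_add[symmetric] by (simp add: algebra_simps)
      also have "((2 + 1 / \<delta>) * K) * \<dots> \<le> W y"
        unfolding W_def using 2 TK(2) by simp
      finally show ?thesis
        using 2 U_nonneg by (simp add: scaled_def tail_U abs_mult)
    next
      case 3
      have "U (real n / y) / U (real n) \<le> K * y powr (\<delta> - \<alpha>)"
        using TK(4)[OF N0(1)[OF n], of y] 3 Upos by (simp add: field_simps)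
      moreover have "\<bar>bias_deriv n y\<bar> \<le> 1 / y"
        by (rule bias_deriv_bounds) (use n1 3 in auto)
      ultimately have "\<bar>bias_deriv n y\<bar> * (U (real n / y) / U (real n)) \<le>
          (1 / y) * (K * y powr (\<delta> - \<alpha>))"
        by (intro mult_mono) (use U_nonneg 3 in auto)
      also have "\<dots> = K * y powr (\<delta> - \<alpha> - 1)"
        using 3 by (simp add: powr_diff)
      also have "\<dots> = W y"
        unfolding W_def using 3 by simp
      finally show ?thesis
        using 3 U_nonneg by (simp add: scaled_def tail_U abs_mult)
    next
      case 4
      then have "tail_count p (y / real n) = 0"
        using n1 by (intro tail_count_eq_0) auto
      then show ?thesis using W_nonneg by (simp add: scaled_def)
    qed
  qed
qed

lemma scaled_integral_tendsto:
  "\<forall>\<^sub>F n in sequentially. integrable lborel (scaled n)"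
  "(\<lambda>n. integral\<^sup>L lborel (scaled n)) \<longlonglongrightarrow> C_const \<alpha>"
proof -
  obtain N0 :: nat and W where W: "N0 \<ge> 1" "integrable lborel W"
    "\<And>n y. n \<ge> N0 \<Longrightarrow> \<bar>scaled n y\<bar> \<le> W y"
    using scaled_dominated by metis
  have meas: "scaled (n + N0) \<in> borel_measurable lborel" for n
    using scaled_measurable[of "n + N0"] W(1) by simp
  have lim: "(\<lambda>n. scaled (n + N0) y) \<longlonglongrightarrow> indicator {0<..} y * (y powr (- \<alpha>) * psi y)" for y
    using scaled_tendsto by (rule LIMSEQ_ignore_initial_segment)
  have lim_meas: "(\<lambda>y. indicator {0<..} y * (y powr (- \<alpha>) * psi y)) \<in> borel_measurable lborel"
    by (rule borel_measurable_LIMSEQ_real[OF lim meas])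
  have int: "integrable lborel (scaled (n + N0))" for n
    by (rule integrable_dominated_convergence2[OF lim_meas meas W(2)]) (use lim W(3) in auto)
  then show "\<forall>\<^sub>F n in sequentially. integrable lborel (scaled n)"
    unfolding eventually_sequentially by (metis add.commute le_Suc_ex)
  have "(\<lambda>n. integral\<^sup>L lborel (scaled (n + N0))) \<longlonglongrightarrow>
      (\<integral>y. indicator {0<..} y * (y powr (- \<alpha>) * psi y) \<partial>lborel)"
    by (rule integral_dominated_convergence[OF lim_meas meas W(2)]) (use lim W(3) in auto)
  then have "(\<lambda>n. integral\<^sup>L lborel (scaled (n + N0))) \<longlonglongrightarrow> C_const \<alpha>"
    by (simp add: C_const_def set_lebesgue_integral_def)
  then show "(\<lambda>n. integral\<^sup>L lborel (scaled n)) \<longlonglongrightarrow> C_const \<alpha>"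
    by (rule LIMSEQ_offset)
qed

definition bias_sum :: "nat \<Rightarrow> real"
  where "bias_sum n = (\<Sum>j. bias_fun n (real n * p j))"

lemma bias_fun_sums:
  "\<forall>\<^sub>F n in sequentially. (\<lambda>j. bias_fun n (real n * p j)) sums (U (real n) * integral\<^sup>L lborel (scaled n))"
proof -
  from eventually_U_nat_pos scaled_integral_tendsto(1) eventually_ge_at_top[of "1::nat"] show ?thesis
  proof eventually_elim
    case (elim n)
    have eq: "indicator {0<..} y * (bias_deriv n y * real (tail_count p (y / real n))) =
        U (real n) * scaled n y" for y
      using elim by (simp add: scaled_def)
    have "integrable lborel
      (\<lambda>y. indicator {0<..} y * (bias_deriv n y * real (tail_count p (y / real n))))"
      unfolding eq using elim by simp
    from bias_fun_sums_integral[OF _ this] show ?case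
      using elim unfolding eq by simp
  qed
qed

lemma bias_sum_asymp: "(\<lambda>n. bias_sum n / U (real n)) \<longlonglongrightarrow> C_const \<alpha>"
proof -
  from eventually_U_nat_pos bias_fun_sums have "\<forall>\<^sub>F n in sequentially.
      integral\<^sup>L lborel (scaled n) = bias_sum n / U (real n)"
  proof eventually_elim
    case (elim n)
    then have "bias_sum n = U (real n) * integral\<^sup>L lborel (scaled n)"
      unfolding bias_sum_def by (intro sums_unique[symmetric])
    then show ?case using elim by simp
  qed
  then show ?thesis using scaled_integral_tendsto(2) by (rule Lim_transform_eventually[rotated])
qed

text \<open>
  Only the symbols with \<open>1 / 4 \<le> n p\<^sub>j < 1 / 2\<close> are retained. For these \<open>- y * ln y \<ge> ln 2 / 4\<close>
  at \<open>y = n p\<^sub>j\<close>.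
\<close>
lemma bias_sum_ge:
  assumes "n \<ge> 1" and summ: "summable (\<lambda>j. bias_fun n (real n * p j))"
  shows "ln 2 / 4 * (U (4 * real n) - U (2 * real n)) \<le> bias_sum n"
proof -
  let ?A = "{j. p j \<ge> 1 / (4 * real n)}" and ?B = "{j. p j \<ge> 1 / (2 * real n)}"
  have fin: "finite ?A" by (rule finite_ge) (use assms in auto)
  have sub: "?B \<subseteq> ?A"
  proof -
    have "1 / (4 * real n) \<le> 1 / (2 * real n)" using assms by (simp add: field_simps)
    then show ?thesis by auto
  qed
  have "real (card (?A - ?B)) = U (4 * real n) - U (2 * real n)"
    using fin sub by (simp add: card_Diff_subset finite_subset card_mono of_nat_diff U_def tail_count_def)
  then have "ln 2 / 4 * (U (4 * real n) - U (2 * real n)) = (\<Sum>j\<in>?A - ?B. ln 2 / 4)" by simp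
  also have "\<dots> \<le> (\<Sum>j\<in>?A - ?B. bias_fun n (real n * p j))"
  proof (rule sum_mono)
    fix j assume "j \<in> ?A - ?B"
    then have y: "1 / 4 \<le> real n * p j" "real n * p j \<le> 1 / 2"
      using assms by (auto simp: field_simps)
    define y where "y = real n * p j"
    have "ln y \<le> ln (1 / 2)" using y by (simp add: y_def)
    then have "ln 2 \<le> - ln y" by (simp add: ln_div)
    then have "1 / 4 * ln 2 \<le> y * (- ln y)"
      using y by (intro mult_mono) (auto simp: y_def)
    also have "\<dots> \<le> bias_fun n y"
      using bias_fun_ge[of n y] y assms p_le_1[of j] by (simp add: y_def)
    finally show "ln 2 / 4 \<le> bias_fun n (real n * p j)" by (simp add: y_def)
  qed
  also have "\<dots> \<le> bias_sum n"
    unfolding bias_sum_def using fin assms p_pos p_le_1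
    by (intro sum_le_suminf summ) (auto intro!: bias_fun_nonneg)
  finally show ?thesis .
qed

text \<open>
  Dividing \<open>bias_sum_ge\<close> by \<open>U n\<close> and passing to the limit bounds \<open>C_const \<alpha>\<close> from below by
  \<open>ln 2 / 4 * (4 powr \<alpha> - 2 powr \<alpha>)\<close>.
\<close>
lemma C_const_pos: "C_const \<alpha> > 0"
proof -
  have "(\<lambda>n. ln 2 / 4 * (U (4 * real n) / U (real n) - U (2 * real n) / U (real n))) \<longlonglongrightarrow>
      ln 2 / 4 * (4 powr \<alpha> - 2 powr \<alpha>)"
    by (intro tendsto_intros U_ratio_nat) auto
  moreover note bias_sum_asymp
  moreover from eventually_U_nat_pos bias_fun_sums eventually_ge_at_top[of "1::nat"]
  have "\<forall>\<^sub>F n in sequentially. ln 2 / 4 * (U (4 * real n) / U (real n) - U (2 * real n) / U (real n))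
      \<le> bias_sum n / U (real n)"
  proof eventually_elim
    case (elim n)
    have "ln 2 / 4 * (U (4 * real n) - U (2 * real n)) \<le> bias_sum n"
      using elim by (intro bias_sum_ge sums_summable[OF elim(2)])
    then have "ln 2 / 4 * (U (4 * real n) - U (2 * real n)) / U (real n) \<le> bias_sum n / U (real n)"
      using elim by (intro divide_right_mono) auto
    then show ?case by (simp only: times_divide_eq_right flip: diff_divide_distrib)
  qed
  ultimately have "ln 2 / 4 * (4 powr \<alpha> - 2 powr \<alpha>) \<le> C_const \<alpha>"
    by (intro tendsto_le[OF sequentially_bot])
  moreover have "2 powr \<alpha> < 4 powr \<alpha>" using alpha by (intro powr_less_mono2) auto
  then have "0 < ln 2 / 4 * (4 powr \<alpha> - 2 powr \<alpha>)" by simp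
  ultimately show ?thesis by linarith
qed

text \<open>
  Adding the convergent series of the \<open>bias_fun\<close> terms to that of \<open>expected_plugin_entropy_sums\<close>
  leaves the entropy series, which is thereby seen to converge.
\<close>
lemma entropy_bias_eq:
  fixes X :: "nat \<Rightarrow> 'a \<Rightarrow> nat"
  assumes "multinomial_vector M n p X" "n \<ge> 1" "summable (\<lambda>j. bias_fun n (real n * p j))"
  shows "(\<integral>\<omega>. plugin_entropy n (\<lambda>j. X j \<omega>) \<partial>M) - shannon_entropy p = - (bias_sum n / real n)"
proof -
  let ?E = "\<integral>\<omega>. plugin_entropy n (\<lambda>j. X j \<omega>) \<partial>M"
  have "(\<lambda>j. bias_fun n (real n * p j) / real n) sums (bias_sum n / real n)"
    unfolding bias_sum_def by (intro sums_divide summable_sums assms(3))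
  from sums_add[OF expected_plugin_entropy_sums[OF assms(1,2) p_pos p_sums] this]
  have "(\<lambda>j. - (p j * ln (p j))) sums (?E + bias_sum n / real n)" by simp
  from sums_minus[OF this] have "(\<lambda>j. p j * ln (p j)) sums (- (?E + bias_sum n / real n))" by simp
  from sums_unique[OF this, symmetric] show ?thesis by (simp add: shannon_entropy_def)
qed

end

theorem corollary4p2:
  fixes p :: "nat \<Rightarrow> real"
    and \<alpha> :: real
    and L :: "real \<Rightarrow> real"
    and M :: "nat \<Rightarrow> 'a measure"
    and X :: "nat \<Rightarrow> nat \<Rightarrow> 'a \<Rightarrow> nat"
  assumes p_pos: "\<And>j. p j > 0"
    and p_sums: "p sums 1"
    and alpha: "0 < \<alpha>" "\<alpha> < 1"
    and slow: "slowly_varying L"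
    and nu: "\<And>x. x \<in> {0<..1} \<Longrightarrow> real (tail_count p x) = x powr (- \<alpha>) * L (1 / x)"
    and sample: "\<And>n. n \<ge> 2 \<Longrightarrow> multinomial_vector (M n) n p (X n)"
  shows "(\<lambda>n. \<bar>(\<integral>\<omega>. plugin_entropy n (\<lambda>j. X n j \<omega>) \<partial>M n) - shannon_entropy p\<bar> /
              (real n powr (\<alpha> - 1) * L (real n) * C_const \<alpha>)) \<longlonglongrightarrow> 1"
proof -
  interpret regular_tail p \<alpha> L
    by unfold_locales (fact p_pos p_sums alpha slow nu)+
  have "(\<lambda>n. \<bar>bias_sum n / U (real n)\<bar> / C_const \<alpha>) \<longlonglongrightarrow> \<bar>C_const \<alpha>\<bar> / C_const \<alpha>"
    using C_const_pos by (intro tendsto_intros bias_sum_asymp) simp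
  then have lim: "(\<lambda>n. \<bar>bias_sum n / U (real n)\<bar> / C_const \<alpha>) \<longlonglongrightarrow> 1"
    using C_const_pos by simp
  have "\<forall>\<^sub>F n in sequentially. \<bar>bias_sum n / U (real n)\<bar> / C_const \<alpha> =
      \<bar>(\<integral>\<omega>. plugin_entropy n (\<lambda>j. X n j \<omega>) \<partial>M n) - shannon_entropy p\<bar> /
              (real n powr (\<alpha> - 1) * L (real n) * C_const \<alpha>)"
    using bias_fun_sums eventually_ge_at_top[of "2::nat"]
  proof eventually_elim
    case (elim n)
    have bias: "(\<integral>\<omega>. plugin_entropy n (\<lambda>j. X n j \<omega>) \<partial>M n) - shannon_entropy p = - (bias_sum n / real n)"
      using elim by (intro entropy_bias_eq sample sums_summable[OF elim(1)]) auto
    have "real n powr (\<alpha> - 1) * L (real n) = U (real n) / real n"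
      using elim by (simp add: U_eq powr_diff)
    then show ?case
      unfolding bias using elim U_nonneg[of "real n"] by (simp add: abs_div)
  qed
  from Lim_transform_eventually[OF lim this] show ?thesis .
qed

end
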